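(* Let $\Omega\subseteq\mathbb{R}^n$ be an open set, $C\subseteq\Omega$ a closed convex set, $f:\Omega\to\mathbb{R}^n$ a continuously differentiable function, $g:\Omega\to\mathbb{R}^n$ a continuous function (not necessarily differentiable), and $F:\mathbb{R}^n\rightrightarrows\mathbb{R}^n$ a set-valued mapping with closed graph. Suppose that $x_*\in\Omega$ is a solution of the generalized equation $f(x)+g(x)+F(x)\ni 0$. Assume that: (i) there is $L>0$ such that $\|f'(x)-f'(y)\|\le L\|x-y\|$ for all $x,y\in\Omega$; (ii) there is $M>0$ such that $\|[x,y,z;g]\|\le M$ for all $x,y,z\in\Omega$, where $[x,y,z;g]$ denotes the second-order divided difference of $g$; (iii) the mapping $f+g+F$ is metrically regular at $x_*$ for $0$ with constants $\kappa>0$, $a>0$, $b>0$. Let $B_0\in\mathscr{L}(\mathbb{R}^n,\mathbb{R}^n)$ satisfy $\delta:=\|B_0-f'(x_* )\|<\frac{1}{2\kappa}$, and let $(\theta_k)_{k\in\mathbb{N}}\subset[0,+\infty)$ be a sequence with $\hat\theta=\sup_{k\in\mathbb{N}}\theta_k<\frac12$. Then there exists $\tau>0$ such that, for any initial points $x_{-1},x_0\in B_\tau[x_*]\cap C$, there exists a sequence $(x_k)_{k\in\mathbb{N}}\subset B_\tau[x_*]\cap C$ generated by the Inexact Broyden Quasi-Newton Secant-Type Method (described in the context) with starting points $x_{-1},x_0$, initial operator $B_0$ and forcing sequence $(\theta_k)$, which converges $q$-linearly to $x_*$. If, in addition, $f+g+F$ is strongly metrically regular at $x_*$ for $0$, then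 the sequence $(x_k)_{k\in\mathbb{N}}$ starting from $x_{-1},x_0$ is unique and converges $q$-linearly to $x_*$.
   Context: **Notation.** $\|\cdot\|$ is the Euclidean norm on $\mathbb{R}^n$, and $B_r[x]=\{y\in\mathbb{R}^n:\|x-y\|\le r\}$. $\mathscr{L}(\mathbb{R}^n,\mathbb{R}^n)$ is the space of linear maps $\mathbb{R}^n\to\mathbb{R}^n$ with the operator norm $\|A\|=\sup\{\|Ax\|:\|x\|\le1\}$. The norm of a bilinear operator is the corresponding operator norm in $\mathscr{L}(\mathbb{R}^n,\mathscr{L}(\mathbb{R}^n,\mathbb{R}^n))$. For a set-valued mapping $G$, $G^{-1}(u)=\{x:u\in G(x)\}$. Also $d(x,D)=\inf_{\hat x\in D}\|x-\hat x\|$, with $d(x,\emptyset)=+\infty$. Convergence of $(x_k)$ to $x_*$ is $q$-linear if there is $\gamma\in(0,1)$ with $\|x_{k+1}-x_*\|\le\gamma\|x_k-x_*\|$ for all sufficiently large $k$. **Divided differences.** For distinct $x,y\in\Omega$, the first-order divided difference of $g$ at $x,y$ is an operator $[x,y;g]\in\mathscr{L}(\mathbb{R}^n,\mathbb{R}^n)$ satisfying $[x,y;g](y-x)=g(y)-g(x)$; when $g$ is differentiable at $x$, $[x,x;g]=g'(x)$. For pairwise distinct $x,y,z\in\Omega$, the second-order divided difference is an operator $[x,y,z;g]\in\mathscr{L}(\mathbb{R}^n,\mathscr{L}(\mathbb{R}^n,\mathbb{R}^n))$ satisfying $[x,y,z;g](z-x)=[y,z;g]-[x,y;g]$; when $g$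 is twice differentiable at $x$, $[x,x,x;g]=\frac12 g''(x)$. A choice of divided differences of $g$ is fixed throughout. **Metric regularity.** A set-valued mapping $G:\Omega\rightrightarrows\mathbb{R}^m$ is metrically regular at $\bar x\in\Omega$ for $\bar u\in\mathbb{R}^m$ with constants $\kappa>0$, $a>0$, $b>0$ if $\bar u\in G(\bar x)$, the graph of $G$ is locally closed at $(\bar x,\bar u)$, $B_a[\bar x]\subset\Omega$, and $d(x,G^{-1}(u))\le\kappa\, d(u,G(x))$ for all $(x,u)\in B_a[\bar x]\times B_b[\bar u]$. If, in addition, $u\mapsto G^{-1}(u)\cap B_a[\bar x]$ is single-valued on $B_b[\bar u]$, then $G$ is strongly metrically regular at $\bar x$ for $\bar u$. **Feasible inexact projection.** For $x\in C$, $\theta\ge0$ and $y\in\mathbb{R}^n$, $$P_C(y,x,\theta):=\{w\in C:\ \langle y-w,z-w\rangle\le\theta\|y-x\|^2\ \text{ for all } z\in C\}.$$ **CondG procedure** (used to compute a point of $P_C(v,u,\theta)$). Given $\theta\ge0$, $v\in\mathbb{R}^n$, $u\in C$ and a starting point $w\in C$ ($w\ne v$), set $w_0=w$, $\ell=0$. (1) Using a linear optimization oracle, compute $z_\ell\in\arg\min_{z\in C}\langle w_\ell-v,z-w_\ell\rangle$ and $s_\ell^*=\langle w_\ell-v,z_\ell-w_\ell\rangle$. (2) If $-s_\ell^*\le\theta\|v-u\|^2$, stop and output $w^+=w_\ell$. (3) Otherwise set $\alpha_\ell=\min\{1,-s_\ell^*/\|z_\ell-w_\ell\|^2\}$ and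 $w_{\ell+1}=w_\ell+\alpha_\ell(z_\ell-w_\ell)$. (4) Replace $\ell$ by $\ell+1$ and return to (1). **Inexact Broyden Quasi-Newton Secant-Type Method.** Step 0: Start with $x_{-1},x_0\in C$, $(\theta_k)_{k\in\mathbb{N}}\subset[0,+\infty)$ and $B_0\in\mathscr{L}(\mathbb{R}^n,\mathbb{R}^n)$; set $k=0$. Step 1: If $0\in f(x_k)+g(x_k)+F(x_k)$, stop. Otherwise compute $y_k\in\mathbb{R}^n$ (with $f(y_k)$ defined) satisfying $$0\in f(x_k)+g(x_k)+\big(B_k+[x_{k-1},x_k;g]\big)(y_k-x_k)+F(y_k),$$ set $s_k:=y_k-x_k$, $z_k:=f(y_k)-f(x_k)$, and $$B_{k+1}:=B_k+\frac{(z_k-B_ks_k)s_k^\top}{\|s_k\|^2}.$$ Step 2: If $y_k\in C$, set $x_{k+1}=y_k$. Otherwise compute $x_{k+1}\in P_C(y_k,x_k,\theta_k)$ using the CondG procedure (with $v=y_k$, $u=x_k$, $\theta=\theta_k$). Step 3: Replace $k$ by $k+1$ and return to Step 1. **Standing assumption.** The sequence $(x_k)_{k\in\mathbb{N}}$ generated by the method is assumed to be infinite (the method does not stop in Step 1); in this case the paper takes $x_k\ne x_*$ and $x_{k+1}\ne x_k$ for all $k$.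
   Formalization: In the strong case, uniqueness and convergence concern runs whose y_k also lie in B_τ[x_*], and uniqueness is for fixed CondG outputs, since other y_k or outputs give other sequences. The run may stop at a solution; q-linear convergence is claimed when it is infinite. *)

theory Defs
  imports "HOL-Analysis.Analysis"
begin

section \<open>Set-valued mappings and metric regularity\<close>

text \<open>
  A set-valued mapping \<open>G\<close> on a domain \<open>D\<close> is a total function into sets together with \<open>D\<close>; its
  values outside \<open>D\<close> are ignored.
\<close>

definition sv_graph :: "'a set \<Rightarrow> ('a \<Rightarrow> 'b set) \<Rightarrow> ('a \<times> 'b) set" where
  "sv_graph D G = {(x, u). x \<in> D \<and> u \<in> G x}"

definition sv_inverse :: "'a set \<Rightarrow> ('a \<Rightarrow> 'b set) \<Rightarrow> 'b \<Rightarrow> 'a set" where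
  "sv_inverse D G u = {x \<in> D. u \<in> G x}"

text \<open>
  The library's \<open>infdist\<close> and \<open>setdist\<close> are \<open>0\<close> on the empty set; here the distance to the empty
  set is \<open>\<infinity>\<close>, the infimum of the empty family in the extended nonnegative reals.
\<close>

definition dist_to :: "'a::real_normed_vector \<Rightarrow> 'a set \<Rightarrow> ennreal" where
  "dist_to x D = (INF y\<in>D. ennreal (norm (x - y)))"

definition locally_closed_at :: "'a::topological_space set \<Rightarrow> 'a \<Rightarrow> bool" where
  "locally_closed_at S p \<longleftrightarrow> (\<exists>U. closed U \<and> p \<in> interior U \<and> closed (S \<inter> U))"

definition metrically_regular ::
  "'a::real_normed_vector set \<Rightarrow> ('a \<Rightarrow> 'b::real_normed_vector set) \<Rightarrow> 'a \<Rightarrow> 'b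
    \<Rightarrow> real \<Rightarrow> real \<Rightarrow> real \<Rightarrow> bool" where
  "metrically_regular D G xb ub \<kappa> a b \<longleftrightarrow>
     \<kappa> > 0 \<and> a > 0 \<and> b > 0 \<and>
     xb \<in> D \<and> ub \<in> G xb \<and>
     locally_closed_at (sv_graph D G) (xb, ub) \<and>
     cball xb a \<subseteq> D \<and>
     (\<forall>x\<in>cball xb a. \<forall>u\<in>cball ub b.
        dist_to x (sv_inverse D G u) \<le> ennreal \<kappa> * dist_to u (G x))"

definition strongly_metrically_regular ::
  "'a::real_normed_vector set \<Rightarrow> ('a \<Rightarrow> 'b::real_normed_vector set) \<Rightarrow> 'a \<Rightarrow> 'b
    \<Rightarrow> real \<Rightarrow> real \<Rightarrow> real \<Rightarrow> bool" where
  "strongly_metrically_regular D G xb ub \<kappa> a b \<longleftrightarrow>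
     metrically_regular D G xb ub \<kappa> a b \<and>
     (\<forall>u\<in>cball ub b. \<exists>!x. x \<in> sv_inverse D G u \<inter> cball xb a)"

definition sum_map :: "('a \<Rightarrow> 'b::plus) \<Rightarrow> ('a \<Rightarrow> 'b) \<Rightarrow> ('a \<Rightarrow> 'b set) \<Rightarrow> 'a \<Rightarrow> 'b set" where
  "sum_map f g F x = {f x + g x + v | v. v \<in> F x}"

section \<open>Divided differences\<close>

text \<open>
  A choice of divided differences is a total function on pairs (triples) of points. Off the cases
  below, e.g. at \<open>(x, x)\<close> when \<open>g\<close> is not differentiable at \<open>x\<close>, its values are unconstrained.
\<close>

definition divided_difference ::
  "'a::real_normed_vector set \<Rightarrow> ('a \<Rightarrow> 'b::real_normed_vector) \<Rightarrow> ('a \<Rightarrow> 'a \<Rightarrow> ('a \<Rightarrow>\<^sub>L 'b)) \<Rightarrow> bool"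
  where
  "divided_difference D g dd \<longleftrightarrow>
     (\<forall>x\<in>D. \<forall>y\<in>D. x \<noteq> y \<longrightarrow> blinfun_apply (dd x y) (y - x) = g y - g x) \<and>
     (\<forall>x\<in>D. \<forall>A. (g has_derivative blinfun_apply A) (at x) \<longrightarrow> dd x x = A)"

definition divided_difference2 ::
  "'a::real_normed_vector set \<Rightarrow> ('a \<Rightarrow> 'b::real_normed_vector) \<Rightarrow> ('a \<Rightarrow> 'a \<Rightarrow> ('a \<Rightarrow>\<^sub>L 'b))
    \<Rightarrow> ('a \<Rightarrow> 'a \<Rightarrow> 'a \<Rightarrow> ('a \<Rightarrow>\<^sub>L ('a \<Rightarrow>\<^sub>L 'b))) \<Rightarrow> bool" where
  "divided_difference2 D g dd dd2 \<longleftrightarrow>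
     (\<forall>x\<in>D. \<forall>y\<in>D. \<forall>z\<in>D. x \<noteq> y \<and> y \<noteq> z \<and> x \<noteq> z \<longrightarrow>
        blinfun_apply (dd2 x y z) (z - x) = dd y z - dd x y) \<and>
     (\<forall>x\<in>D. \<forall>Dg H. (\<forall>\<^sub>F y in nhds x. (g has_derivative blinfun_apply (Dg y)) (at y)) \<and>
        (Dg has_derivative blinfun_apply H) (at x) \<longrightarrow> dd2 x x x = (1/2) *\<^sub>R H)"

section \<open>Inexact projections and the conditional gradient procedure\<close>

definition inexact_proj :: "'a::real_inner set \<Rightarrow> 'a \<Rightarrow> 'a \<Rightarrow> real \<Rightarrow> 'a set" where
  "inexact_proj C y x \<theta> = {w \<in> C. \<forall>z\<in>C. (y - w) \<bullet> (z - w) \<le> \<theta> * (norm (y - x))\<^sup>2}"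

text \<open>
  \<open>condG_output C \<theta> v u w'\<close>: for some starting point and some answers of the linear optimization
  oracle, the procedure stops after finitely many iterations and returns \<open>w'\<close>. Here \<open>w i\<close> are the
  inner iterates, \<open>z i\<close> the oracle answers, and \<open>l\<close> is the index at which the procedure stops.
\<close>

definition condG_output :: "'a::real_inner set \<Rightarrow> real \<Rightarrow> 'a \<Rightarrow> 'a \<Rightarrow> 'a \<Rightarrow> bool" where
  "condG_output C \<theta> v u w' \<longleftrightarrow>
     (\<exists>w z s l. w 0 \<in> C \<and> w 0 \<noteq> v \<and>
        (\<forall>i\<le>l. is_arg_min (\<lambda>p. (w i - v) \<bullet> (p - w i)) (\<lambda>p. p \<in> C) (z i) \<and>
               s i = (w i - v) \<bullet> (z i - w i)) \<and>
        (\<forall>i<l. \<not> - s i \<le> \<theta> * (norm (v - u))\<^sup>2 \<and>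
               w (Suc i) = w i + min 1 (- s i / (norm (z i - w i))\<^sup>2) *\<^sub>R (z i - w i)) \<and>
        - s l \<le> \<theta> * (norm (v - u))\<^sup>2 \<and>
        w' = w (l::nat))"

section \<open>The inexact Broyden quasi-Newton secant-type method\<close>

text \<open>The operator of the matrix \<open>c s\<^sup>T\<close>, i.e. \<open>h \<mapsto> (s \<bullet> h) c\<close>.\<close>

definition outer_prod :: "'a::real_inner \<Rightarrow> 'a \<Rightarrow> ('a \<Rightarrow>\<^sub>L 'a)" where
  "outer_prod c s = blinfun_scaleR_left c o\<^sub>L blinfun_inner_right s"

definition broyden_update :: "('a::real_inner \<Rightarrow>\<^sub>L 'a) \<Rightarrow> 'a \<Rightarrow> 'a \<Rightarrow> ('a \<Rightarrow>\<^sub>L 'a)" where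
  "broyden_update B s z = B + (1 / (norm s)\<^sup>2) *\<^sub>R outer_prod (z - blinfun_apply B s) s"

text \<open>
  A complete run of the method from \<open>xm\<close> (the point with index \<open>-1\<close>) and \<open>x0\<close>. \<open>N\<close> is the index at
  which the stopping test succeeds, and \<open>N = \<infinity>\<close> if it never does; entries of \<open>x\<close> and \<open>B\<close> beyond
  \<open>N\<close>, and of \<open>y\<close> from \<open>N\<close> on, are irrelevant.

  The starting point and the oracle answers in the conditional gradient procedure are free. The
  parameter \<open>P\<close> records how they are resolved: \<open>P k v u\<close> is the point that the procedure returns in
  iteration \<open>k\<close> for the data \<open>v\<close>, \<open>u\<close>. It is only consulted where the procedure is called, and
  there it has to be a genuine output of the procedure.
\<close>

definition broyden_secant_run ::
  "'a::real_inner set \<Rightarrow> 'a set \<Rightarrow> ('a \<Rightarrow> 'a) \<Rightarrow> ('a \<Rightarrow> 'a) \<Rightarrow> ('a \<Rightarrow> 'a \<Rightarrow> ('a \<Rightarrow>\<^sub>L 'a)) \<Rightarrow>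
   ('a \<Rightarrow> 'a set) \<Rightarrow> (nat \<Rightarrow> real) \<Rightarrow> (nat \<Rightarrow> 'a \<Rightarrow> 'a \<Rightarrow> 'a) \<Rightarrow> 'a \<Rightarrow> 'a \<Rightarrow> ('a \<Rightarrow>\<^sub>L 'a) \<Rightarrow>
   enat \<Rightarrow> (nat \<Rightarrow> 'a) \<Rightarrow> (nat \<Rightarrow> 'a) \<Rightarrow> (nat \<Rightarrow> ('a \<Rightarrow>\<^sub>L 'a)) \<Rightarrow> bool" where
  "broyden_secant_run \<Omega> C f g dd F \<theta> P xm x0 B0 N x y B \<longleftrightarrow>
     xm \<in> C \<and> x0 \<in> C \<and> x 0 = x0 \<and> B 0 = B0 \<and>
     (\<forall>k. enat k < N \<longrightarrow>
        0 \<notin> sum_map f g F (x k) \<and>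
        y k \<in> \<Omega> \<and>
        0 \<in> {f (x k) + g (x k)
               + blinfun_apply (B k + dd (case k of 0 \<Rightarrow> xm | Suc j \<Rightarrow> x j) (x k)) (y k - x k)
               + v | v. v \<in> F (y k)} \<and>
        B (Suc k) = broyden_update (B k) (y k - x k) (f (y k) - f (x k)) \<and>
        (if y k \<in> C then x (Suc k) = y k
         else x (Suc k) = P k (y k) (x k) \<and>
              x (Suc k) \<in> inexact_proj C (y k) (x k) (\<theta> k) \<and>
              condG_output C (\<theta> k) (y k) (x k) (x (Suc k)))) \<and>
     (\<forall>m. N = enat m \<longrightarrow> 0 \<in> sum_map f g F (x m))"

definition run_within ::
  "'a::metric_space \<Rightarrow> real \<Rightarrow> 'a set \<Rightarrow> enat \<Rightarrow> (nat \<Rightarrow> 'a) \<Rightarrow> (nat \<Rightarrow> 'a) \<Rightarrow> bool" where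
  "run_within xs \<tau> C N x y \<longleftrightarrow>
     (\<forall>k. enat k \<le> N \<longrightarrow> x k \<in> cball xs \<tau> \<inter> C) \<and>
     (\<forall>k. enat k < N \<longrightarrow> y k \<in> cball xs \<tau>)"

definition q_linearly_convergent :: "(nat \<Rightarrow> 'a::real_normed_vector) \<Rightarrow> 'a \<Rightarrow> bool" where
  "q_linearly_convergent x xs \<longleftrightarrow>
     x \<longlonglongrightarrow> xs \<and>
     (\<exists>\<gamma>. 0 < \<gamma> \<and> \<gamma> < 1 \<and>
        (\<forall>\<^sub>F k in sequentially. norm (x (Suc k) - xs) \<le> \<gamma> * norm (x k - xs)))"

end

theory Submission
  imports Defs
begin

text \<open>
  Near the solution \<open>xs\<close> the method solves \<open>r k y \<in> (f + g + F) y\<close> for \<open>y\<close>, where the residual \<open>r k\<close> is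
  the error made in replacing \<open>f + g\<close> by its current linear model at \<open>x k\<close>. Everything rests on the
  fact that \<open>r k\<close> has a small Lipschitz constant near \<open>xs\<close>. For the part from \<open>g\<close> this is a
  consequence of the bound on the second divided differences: it makes all first divided differences
  near a point \<open>z\<close> differ by \<open>O(t)\<close> on the ball of radius \<open>t\<close>, so \<open>g\<close> is in fact differentiable with
  derivative \<open>dd z z\<close>, and a secant operator serves as well as a derivative, also when the two points
  that define it coincide (\<open>divided_difference_secant\<close>). For the part from \<open>f\<close> the constant is the
  norm of \<open>E k = B k - f' xs\<close> up to \<open>O(t)\<close>. As long as \<open>\<kappa> * norm (E k) < 1 / 2\<close>, metric regularity
  makes \<open>y \<mapsto> (f + g + F)\<inverse> (r k y)\<close> a set-valued contraction; it has a fixed point \<open>y k\<close> whose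
  distance to \<open>xs\<close> is at most \<open>l / (1 - l) < 1\<close> times that of \<open>x k\<close>, with \<open>l < 1 / 2\<close>
  (\<open>set_valued_contraction\<close>, \<open>step_exists\<close>).

  Existence. The inner procedure may be started at the Euclidean projection of \<open>y k\<close>, where it stops
  at once. As that projection is nonexpansive and fixes \<open>xs\<close>, the errors decay geometrically; one
  update increases \<open>norm (E k)\<close> by at most \<open>L\<close> times the current error, so the total increase is
  \<open>O(\<tau>)\<close> and the condition on \<open>norm (E k)\<close> persists (\<open>run_exists\<close>).

  Convergence of an arbitrary run. Here the inexact projection is adversarial, and since \<open>2 * \<theta> k\<close>
  and \<open>2 * \<kappa> * norm (E k)\<close> may both be close to 1, a single step may well move away from \<open>xs\<close>. What
  saves convergence is that the bad steps are paid for by the Frobenius norm of \<open>E k\<close>. Let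
  \<open>\<sigma> k = norm (E k s) / norm s\<close> for the step \<open>s = y k - x k\<close>. The squared Frobenius norm drops by
  \<open>\<sigma> k ^ 2\<close> in an update, up to the square of \<open>L\<close> times the error, while a step with small \<open>\<sigma> k\<close>
  contracts the error by a fixed \<open>\<rho> < 1\<close> and any step expands it by at most 3. Hence, with \<open>\<phi> k\<close> the
  squared Frobenius norm and a large constant \<open>c\<close>, the product of the error and \<open>exp (c * \<phi> k)\<close> is a
  Lyapunov function that decays geometrically (\<open>lyapunov_decay\<close>). Then the errors are summable,
  which closes the bootstrap for \<open>norm (E k)\<close>, and \<open>\<sigma> k\<close> tends to 0, so that eventually all steps
  contract (\<open>run_decay\<close>).

  Uniqueness. Strong regularity makes the inverse Lipschitz on small values, so the contraction has
  only one fixed point in the ball, and a run is determined by the answers of the inner procedure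
  (\<open>run_unique\<close>).

  If \<open>xs \<notin> C\<close> there are no starting points near \<open>xs\<close>, as \<open>C\<close> is closed.
\<close>

section \<open>Divided differences of bounded second order\<close>

lemma infinite_cball:
  fixes z :: "'a::euclidean_space"
  assumes "t > 0"
  shows "infinite (cball z t)"
proof -
  have "z islimpt UNIV"
    by simp
  then show ?thesis
    using assms unfolding islimpt_eq_infinite_cball by auto
qed

text \<open>
  Replacing the pair \<open>(x, y)\<close> by \<open>(y, w)\<close> changes the first divided difference by a second one applied
  to \<open>w - x\<close>, hence by at most \<open>2 * M * t\<close>; four such replacements, with two auxiliary points,
  lead from any pair of distinct points to any other.
\<close>

lemma divided_difference_oscillation:
  fixes dd :: "'a::euclidean_space \<Rightarrow> 'a \<Rightarrow> 'a \<Rightarrow>\<^sub>L 'b::real_normed_vector"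
  assumes dd2: "divided_difference2 D g dd dd2"
    and bound: "\<And>x y z. x \<in> D \<Longrightarrow> y \<in> D \<Longrightarrow> z \<in> D \<Longrightarrow> norm (dd2 x y z) \<le> M"
    and "cball z t \<subseteq> D"
    and "p \<in> cball z t" "q \<in> cball z t" "p \<noteq> q"
    and "p' \<in> cball z t" "q' \<in> cball z t" "p' \<noteq> q'"
  shows "norm (dd p q - dd p' q') \<le> 8 * M * t"
proof -
  have "0 < t"
    using assms(4-6) by (metis cball_trivial cball_eq_empty empty_iff linorder_neqE_linordered_idom singletonD)
  have "z \<in> D"
    using \<open>cball z t \<subseteq> D\<close> \<open>0 < t\<close> by auto
  then have "0 \<le> M"
    using bound[of z z z] norm_ge_zero order_trans by blast
  have shift: "norm (dd x y - dd y w) \<le> 2 * M * t"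
    if "x \<in> cball z t" "y \<in> cball z t" "w \<in> cball z t" "x \<noteq> y" "y \<noteq> w" "x \<noteq> w" for x y w
  proof -
    have "x \<in> D" "y \<in> D" "w \<in> D"
      using that \<open>cball z t \<subseteq> D\<close> by auto
    then have "blinfun_apply (dd2 x y w) (w - x) = dd y w - dd x y"
      using dd2 that unfolding divided_difference2_def by blast
    then have "norm (dd x y - dd y w) \<le> norm (dd2 x y w) * norm (w - x)"
      by (metis norm_blinfun norm_minus_commute)
    also have "\<dots> \<le> M * (2 * t)"
    proof (rule mult_mono)
      have "dist w x \<le> dist w z + dist z x"
        by (rule dist_triangle)
      then show "norm (w - x) \<le> 2 * t"
        using that by (simp add: dist_norm norm_minus_commute)
    qed (use bound \<open>x \<in> D\<close> \<open>y \<in> D\<close> \<open>w \<in> D\<close> \<open>0 \<le> M\<close> in auto)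
    finally show ?thesis
      by simp
  qed
  have fresh: "\<exists>w\<in>cball z t. w \<notin> S" if "finite S" for S
    using infinite_cball[OF \<open>0 < t\<close>] that by (meson finite_subset subsetI)
  \<comment> \<open>Two fresh points, since \<open>q = p'\<close> or \<open>p = q'\<close> is possible.\<close>
  obtain w where w: "w \<in> cball z t" "w \<notin> {p, q, p', q'}"
    using fresh[of "{p, q, p', q'}"] by auto
  obtain v where v: "v \<in> cball z t" "v \<notin> {p, q, p', q', w}"
    using fresh[of "{p, q, p', q', w}"] by auto
  have "norm (dd p q - dd q w) \<le> 2 * M * t" "norm (dd q w - dd w v) \<le> 2 * M * t"
    "norm (dd w v - dd v p') \<le> 2 * M * t" "norm (dd v p' - dd p' q') \<le> 2 * M * t"
    using assms w v by (intro shift; auto)+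
  then show ?thesis
    using norm_triangle_ineq[of "dd p q - dd q w" "dd q w - dd w v"]
      norm_triangle_ineq[of "dd p q - dd w v" "dd w v - dd v p'"]
      norm_triangle_ineq[of "dd p q - dd v p'" "dd v p' - dd p' q'"]
    by simp
qed

text \<open>
  As \<open>dd\<close> oscillates by \<open>O(t)\<close> on the ball of radius \<open>t\<close>, its values converge as both points tend to
  \<open>z\<close>. The limit is a derivative of \<open>g\<close> at \<open>z\<close>, and therefore the prescribed value \<open>dd z z\<close>.
\<close>

lemma divided_difference_limit:
  fixes g :: "'a::euclidean_space \<Rightarrow> 'b::banach"
  assumes "open D" "cball z t \<subseteq> D"
    and dd: "divided_difference D g dd" and dd2: "divided_difference2 D g dd dd2"
    and bound: "\<And>x y z. x \<in> D \<Longrightarrow> y \<in> D \<Longrightarrow> z \<in> D \<Longrightarrow> norm (dd2 x y z) \<le> M"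
    and x: "x \<in> cball z t" and y: "y \<in> cball z t" and "x \<noteq> y"
  shows "norm (dd x y - dd z z) \<le> 8 * M * t"
proof -
  have "z \<in> D"
    using x \<open>cball z t \<subseteq> D\<close> by (metis centre_in_cball mem_cball order_trans subsetD zero_le_dist)
  have "0 \<le> M"
    using bound[of z z z] \<open>z \<in> D\<close> norm_ge_zero order_trans by blast
  obtain r where r: "r > 0" "cball z r \<subseteq> D"
    using \<open>open D\<close> \<open>z \<in> D\<close> open_contains_cball by blast
  obtain e :: 'a where e: "norm e = 1"
    using vector_choose_size[of 1] by auto
  \<comment> \<open>Points tending to \<open>z\<close> within \<open>D\<close>.\<close>
  define w where "w n = z + (r / (real n + 1)) *\<^sub>R e" for n
  have w_ne: "w n \<noteq> z" for n
    using e r by (auto simp: w_def add_nonneg_eq_0_iff)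
  have w_in: "w n \<in> cball z s" if "r / (real n + 1) \<le> s" for n s
    using that e r by (simp add: w_def dist_norm)
  have small: "\<exists>N. \<forall>n\<ge>N. r / (real n + 1) \<le> s" if "0 < s" for s
  proof -
    have "(\<lambda>n. r / (real n + 1)) \<longlonglongrightarrow> 0"
      using tendsto_mult_right_zero[OF LIMSEQ_inverse_real_of_nat, of r]
      by (simp add: divide_inverse add.commute)
    then have "\<forall>\<^sub>F n in sequentially. r / (real n + 1) < s"
      using that by (rule order_tendstoD)
    then show ?thesis
      unfolding eventually_sequentially using less_imp_le by blast
  qed
  have osc: "norm (dd x y - dd x' y') \<le> 8 * M * t"
    if "cball z t \<subseteq> D" "x \<in> cball z t" "y \<in> cball z t" "x \<noteq> y"
      "x' \<in> cball z t" "y' \<in> cball z t" "x' \<noteq> y'" for t x y x' y'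
    using divided_difference_oscillation[OF dd2 bound] that by blast
  have "Cauchy (\<lambda>n. dd z (w n))"
  proof (rule metric_CauchyI)
    fix \<epsilon> :: real assume "0 < \<epsilon>"
    define s where "s = min r (\<epsilon> / (8 * M + 1))"
    have "0 < s" "s \<le> r"
      using \<open>0 < \<epsilon>\<close> \<open>0 \<le> M\<close> r by (auto simp: s_def)
    have "8 * M * s < \<epsilon>"
    proof -
      have "8 * M * s < (8 * M + 1) * s"
        using \<open>0 < s\<close> by simp
      also have "\<dots> \<le> (8 * M + 1) * (\<epsilon> / (8 * M + 1))"
        using \<open>0 \<le> M\<close> by (intro mult_left_mono) (auto simp: s_def)
      finally show ?thesis
        using \<open>0 \<le> M\<close> by simp
    qed
    moreover obtain N where "\<forall>n\<ge>N. r / (real n + 1) \<le> s"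
      using small \<open>0 < s\<close> by blast
    ultimately have "dist (dd z (w m)) (dd z (w n)) < \<epsilon>" if "m \<ge> N" "n \<ge> N" for m n
      using osc[of s z "w m" z "w n"] w_in w_ne[of m] w_ne[of n] that r \<open>0 < s\<close> \<open>s \<le> r\<close>
      by (force simp: dist_norm)
    then show "\<exists>N. \<forall>m\<ge>N. \<forall>n\<ge>N. dist (dd z (w m)) (dd z (w n)) < \<epsilon>"
      by blast
  qed
  then obtain A where A: "(\<lambda>n. dd z (w n)) \<longlonglongrightarrow> A"
    using Cauchy_convergent_iff convergent_def by blast
  have near: "norm (dd x y - A) \<le> 8 * M * t"
    if "cball z t \<subseteq> D" "x \<in> cball z t" "y \<in> cball z t" "x \<noteq> y" for t x y
  proof -
    have "0 < t"
      using that by (metis cball_trivial cball_eq_empty empty_iff linorder_neqE_linordered_idom singletonD)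
    then obtain N where "\<forall>n\<ge>N. r / (real n + 1) \<le> t"
      using small by blast
    then have "\<forall>\<^sub>F n in sequentially. norm (dd x y - dd z (w n)) \<le> 8 * M * t"
      unfolding eventually_sequentially
      using osc[OF that, of z] w_in w_ne \<open>0 < t\<close>
      by (intro exI[of _ N]) (metis centre_in_cball less_imp_le)
    moreover have "(\<lambda>n. norm (dd x y - dd z (w n))) \<longlonglongrightarrow> norm (dd x y - A)"
      using A by (intro tendsto_intros)
    ultimately show ?thesis
      using tendsto_upperbound trivial_limit_sequentially by blast
  qed
  have "(g has_derivative blinfun_apply A) (at z)"
    unfolding has_derivative_at_alt
  proof (intro conjI allI impI)
    show "bounded_linear (blinfun_apply A)"
      by (rule blinfun.bounded_linear_right)
  next
    fix \<epsilon> :: real assume "0 < \<epsilon>"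
    define s where "s = min r (\<epsilon> / (8 * M + 1))"
    have "0 < s" "s \<le> r"
      using \<open>0 < \<epsilon>\<close> \<open>0 \<le> M\<close> r by (auto simp: s_def)
    have "norm (g y - g z - blinfun_apply A (y - z)) \<le> \<epsilon> * norm (y - z)" if "norm (y - z) < s" for y
    proof (cases "y = z")
      case False
      have "cball z (norm (y - z)) \<subseteq> D"
        using that r \<open>s \<le> r\<close> by (smt (verit, best) mem_cball subset_iff)
      then have "y \<in> D"
        by (auto simp: dist_norm norm_minus_commute)
      then have "g y - g z = blinfun_apply (dd z y) (y - z)"
        using dd \<open>z \<in> D\<close> False unfolding divided_difference_def by auto
      then have "norm (g y - g z - blinfun_apply A (y - z)) \<le> norm (dd z y - A) * norm (y - z)"
        by (metis blinfun.diff_left norm_blinfun)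
      also have "norm (dd z y - A) \<le> 8 * M * norm (y - z)"
        using near[OF \<open>cball z (norm (y - z)) \<subseteq> D\<close>, of z y] False
        by (auto simp: dist_norm norm_minus_commute)
      also have "\<dots> \<le> (8 * M + 1) * (\<epsilon> / (8 * M + 1))"
        using that \<open>0 \<le> M\<close> by (intro mult_mono) (auto simp: s_def)
      also have "\<dots> = \<epsilon>"
        using \<open>0 \<le> M\<close> by simp
      finally show ?thesis
        by (simp add: mult_right_mono)
    qed simp
    then show "\<exists>d>0. \<forall>y. norm (y - z) < d \<longrightarrow>
      norm (g y - g z - blinfun_apply A (y - z)) \<le> \<epsilon> * norm (y - z)"
      using \<open>0 < s\<close> by blast
  qed
  then have "dd z z = A"
    using dd \<open>z \<in> D\<close> unfolding divided_difference_def by blast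
  then show ?thesis
    using near[OF assms(2) x y \<open>x \<noteq> y\<close>] by simp
qed

text \<open>
  The diagonal pair \<open>(x, x)\<close> is reached by letting \<open>v\<close> tend to \<open>x\<close> in \<open>(x, v)\<close>. The points \<open>v\<close> are taken
  on the segment to \<open>z\<close>, since \<open>x\<close> may lie on the boundary of the ball.
\<close>

lemma divided_difference_near:
  fixes g :: "'a::euclidean_space \<Rightarrow> 'b::banach"
  assumes "open D" "cball z t \<subseteq> D"
    and dd: "divided_difference D g dd" and dd2: "divided_difference2 D g dd dd2"
    and bound: "\<And>x y z. x \<in> D \<Longrightarrow> y \<in> D \<Longrightarrow> z \<in> D \<Longrightarrow> norm (dd2 x y z) \<le> M"
    and x: "x \<in> cball z t" and y: "y \<in> cball z t"
  shows "norm (dd x y - dd z z) \<le> 8 * M * t"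
proof (cases "x = y \<and> x \<noteq> z")
  case False
  have "0 \<le> t"
    using x zero_le_dist[of z x] by (simp del: zero_le_dist)
  then have "z \<in> D"
    using assms(2) by auto
  then have "0 \<le> M"
    using bound[of z z z] norm_ge_zero order_trans by blast
  then show ?thesis
    using divided_difference_limit[OF \<open>open D\<close> assms(2) dd dd2 bound x y] False \<open>0 \<le> t\<close>
    by (cases "x = y") auto
next
  case True
  have "x \<in> D"
    using x \<open>cball z t \<subseteq> D\<close> by blast
  have near_z: "norm (dd x v - dd z z) \<le> 8 * M * t" if "v \<in> cball z t" "x \<noteq> v" for v
    using divided_difference_limit[OF \<open>open D\<close> assms(2) dd dd2 bound x] that by blast
  have near_x: "norm (dd x v - dd x x) \<le> 8 * M * s"
    if "cball x s \<subseteq> D" "v \<in> cball x s" "x \<noteq> v" for v s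
  proof -
    have "x \<in> cball x s"
      using that by auto (metis order_trans zero_le_dist)
    then show ?thesis
      using divided_difference_limit[OF \<open>open D\<close> that(1) dd dd2 bound] that by blast
  qed
  obtain r where r: "r > 0" "cball x r \<subseteq> D"
    using \<open>open D\<close> \<open>x \<in> D\<close> open_contains_cball by blast
  define d where "d = norm (z - x)"
  have "d > 0"
    using True by (auto simp: d_def)
  have "norm (dd x x - dd z z) \<le> 8 * M * t + 8 * M * s"
    if "0 < s" "s < min r d" for s
  proof -
    define v where "v = x + (s / d) *\<^sub>R (z - x)"
    have "norm (v - x) = s"
      using that \<open>d > 0\<close> by (simp add: v_def d_def)
    moreover have "v \<in> cball z t"
    proof -
      have "v \<in> closed_segment x z"
        unfolding closed_segment_def v_def using that \<open>d > 0\<close>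
        by (intro CollectI exI[of _ "s / d"]) (auto simp: algebra_simps)
      moreover have "closed_segment x z \<subseteq> cball z t"
        using x by (intro closed_segment_subset) (auto intro: order_trans[OF zero_le_dist])
      ultimately show ?thesis
        by blast
    qed
    moreover have "cball x s \<subseteq> D"
      using r that by auto
    moreover have "x \<noteq> v"
      using \<open>norm (v - x) = s\<close> that by auto
    ultimately have "norm (dd x v - dd z z) \<le> 8 * M * t" "norm (dd x v - dd x x) \<le> 8 * M * s"
      using near_z near_x[of s v] by (auto simp: dist_norm norm_minus_commute)
    then show ?thesis
      using norm_triangle_ineq[of "dd x x - dd x v" "dd x v - dd z z"]
      by (simp add: norm_minus_commute)
  qed
  then have "\<forall>\<^sub>F s in at_right 0. norm (dd x x - dd z z) \<le> 8 * M * t + 8 * M * s"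
    using r \<open>d > 0\<close> by (intro eventually_at_rightI[of 0 "min r d"]) auto
  moreover have "((\<lambda>s. 8 * M * t + 8 * M * s) \<longlongrightarrow> 8 * M * t + 8 * M * 0) (at_right 0)"
    by (intro tendsto_intros)
  ultimately show ?thesis
    using True tendsto_lowerbound[of "\<lambda>s. 8 * M * t + 8 * M * s" _ "at_right (0::real)"] by auto
qed

text \<open>
  This is how \<open>g\<close> enters the convergence analysis: on a small ball any secant operator approximates
  the increments of \<open>g\<close> with a small relative error.
\<close>

lemma divided_difference_secant:
  fixes g :: "'a::euclidean_space \<Rightarrow> 'b::banach"
  assumes "open D" "cball z t \<subseteq> D"
    and dd: "divided_difference D g dd" and dd2: "divided_difference2 D g dd dd2"
    and bound: "\<And>x y z. x \<in> D \<Longrightarrow> y \<in> D \<Longrightarrow> z \<in> D \<Longrightarrow> norm (dd2 x y z) \<le> M"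
    and v: "v \<in> cball z t" and w: "w \<in> cball z t" and x: "x \<in> cball z t" and y: "y \<in> cball z t"
  shows "norm (g y - g x - blinfun_apply (dd v w) (y - x)) \<le> 16 * M * t * norm (y - x)"
proof (cases "x = y")
  case False
  then have "g y - g x = blinfun_apply (dd x y) (y - x)"
    using dd x y \<open>cball z t \<subseteq> D\<close> unfolding divided_difference_def by (metis subsetD)
  then have "norm (g y - g x - blinfun_apply (dd v w) (y - x)) \<le> norm (dd x y - dd v w) * norm (y - x)"
    by (metis blinfun.diff_left norm_blinfun)
  also have "\<dots> \<le> 16 * M * t * norm (y - x)"
  proof (rule mult_right_mono)
    have near: "norm (dd p q - dd z z) \<le> 8 * M * t" if "p \<in> cball z t" "q \<in> cball z t" for p q
      using divided_difference_near[OF \<open>open D\<close> \<open>cball z t \<subseteq> D\<close> dd dd2 bound that] by blast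
    then show "norm (dd x y - dd v w) \<le> 16 * M * t"
      using norm_triangle_ineq4[of "dd x y - dd z z" "dd v w - dd z z"] near[OF x y] near[OF v w] by simp
  qed simp
  finally show ?thesis .
qed simp

section \<open>Metric regularity\<close>

text \<open>
  The distance of \<open>x\<close> to the preimage of \<open>u\<close> is an infimum that need not be attained. Enlarging the
  regularity constant from \<open>\<kappa>\<close> to \<open>K\<close> provides an actual point, except if \<open>u = v\<close>, where \<open>x\<close> itself
  will do.
\<close>

lemma metrically_regular_preimage:
  assumes mr: "metrically_regular D G xb ub \<kappa> a b" and "\<kappa> < K"
    and x: "x \<in> cball xb a" and u: "u \<in> cball ub b" and v: "v \<in> G x"
  obtains p where "p \<in> D" "u \<in> G p" "norm (x - p) \<le> K * norm (u - v)"
proof (cases "u = v")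
  case True
  then show ?thesis
    using that[of x] mr x v by (auto simp: metrically_regular_def)
next
  case False
  have "0 < \<kappa>"
    using mr by (simp add: metrically_regular_def)
  have "dist_to x (sv_inverse D G u) \<le> ennreal \<kappa> * dist_to u (G x)"
    using mr x u by (simp add: metrically_regular_def)
  also have "\<dots> \<le> ennreal \<kappa> * ennreal (norm (u - v))"
    unfolding dist_to_def using v by (intro mult_left_mono INF_lower) auto
  also have "\<dots> = ennreal (\<kappa> * norm (u - v))"
    using \<open>0 < \<kappa>\<close> by (simp add: ennreal_mult)
  also have "\<dots> < ennreal (K * norm (u - v))"
    using False \<open>\<kappa> < K\<close> \<open>0 < \<kappa>\<close> by (intro ennreal_lessI) auto
  finally obtain p where "p \<in> sv_inverse D G u" "ennreal (norm (x - p)) < ennreal (K * norm (u - v))"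
    unfolding dist_to_def INF_less_iff by blast
  then show ?thesis
    using that[of p] by (auto simp: sv_inverse_def ennreal_less_iff)
qed

text \<open>
  The constants \<open>\<kappa>'\<close>, \<open>a'\<close>, \<open>b'\<close> of strong regularity are unrelated to those of regularity, and \<open>\<kappa>'\<close> may
  be too large for the convergence analysis. Only the single-valuedness is taken from them: the
  preimage that regularity finds at distance \<open>K * norm (u - u')\<close> lies in the ball of radius \<open>a'\<close>, so
  it is the given one.
\<close>

lemma strongly_metrically_regular_lipschitz:
  assumes mr: "metrically_regular D G xb ub \<kappa> a b" and "\<kappa> < K"
    and smr: "strongly_metrically_regular D G xb ub \<kappa>' a' b'"
    and "r \<le> a" "\<beta> \<le> b" "\<beta> \<le> b'" "r + 2 * K * \<beta> \<le> a'"
    and y: "y \<in> cball xb r" "u \<in> G y" "u \<in> cball ub \<beta>"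
    and y': "y' \<in> cball xb r" "u' \<in> G y'" "u' \<in> cball ub \<beta>"
  shows "norm (y - y') \<le> K * norm (u - u')"
proof -
  have "0 < \<kappa>" "cball xb a \<subseteq> D"
    using mr by (auto simp: metrically_regular_def)
  obtain p where p: "p \<in> D" "u \<in> G p" "norm (y' - p) \<le> K * norm (u - u')"
    using metrically_regular_preimage[OF mr \<open>\<kappa> < K\<close>, of y' u u'] assms by auto
  have "norm (u - u') \<le> 2 * \<beta>"
    using y(3) y'(3) dist_triangle2[of u u' ub] by (simp add: dist_norm norm_minus_commute)
  then have "norm (y' - p) \<le> K * (2 * \<beta>)"
    using p \<open>0 < \<kappa>\<close> \<open>\<kappa> < K\<close> by (smt (verit) mult_left_mono)
  then have "p \<in> cball xb a'"
    using y'(1) \<open>r + 2 * K * \<beta> \<le> a'\<close> dist_triangle[of xb p y'] by (simp add: dist_norm)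
  moreover have "0 \<le> K * (2 * \<beta>)"
    using \<open>norm (y' - p) \<le> K * (2 * \<beta>)\<close> norm_ge_zero order_trans by blast
  then have "y \<in> cball xb a'"
    using y(1) \<open>r + 2 * K * \<beta> \<le> a'\<close> by simp
  moreover have "y \<in> D"
    using y \<open>cball xb a \<subseteq> D\<close> \<open>r \<le> a\<close> by (auto simp: subset_iff)
  moreover have "u \<in> cball ub b'"
    using y \<open>\<beta> \<le> b'\<close> by simp
  ultimately have "y = p"
    using smr p y unfolding strongly_metrically_regular_def sv_inverse_def by blast
  then show ?thesis
    using p by (simp add: norm_minus_commute)
qed

section \<open>Inexact projections\<close>

lemma inexact_proj_dist:
  assumes "w \<in> inexact_proj C y x \<theta>" "z \<in> C"
  shows "(norm (w - z))\<^sup>2 \<le> (norm (y - z))\<^sup>2 + 2 * \<theta> * (norm (y - x))\<^sup>2"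
proof -
  have "(y - w) \<bullet> (z - w) \<le> \<theta> * (norm (y - x))\<^sup>2"
    using assms by (auto simp: inexact_proj_def)
  moreover have "(norm (y - z))\<^sup>2 = (norm (y - w))\<^sup>2 + (norm (w - z))\<^sup>2 - 2 * ((y - w) \<bullet> (z - w))"
    by (simp add: power2_norm_eq_inner inner_commute algebra_simps)
  moreover have "0 \<le> (norm (y - w))\<^sup>2"
    by simp
  ultimately show ?thesis
    by simp
qed

lemma closest_point_inexact_proj:
  assumes "closed C" "convex C" "C \<noteq> {}" "0 \<le> \<theta>"
  shows "closest_point C y \<in> inexact_proj C y x \<theta>"
proof -
  have "(y - closest_point C y) \<bullet> (z - closest_point C y) \<le> \<theta> * (norm (y - x))\<^sup>2" if "z \<in> C" for z
    using closest_point_dot[OF \<open>convex C\<close> \<open>closed C\<close> that, of y] \<open>0 \<le> \<theta>\<close>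
    by (meson mult_nonneg_nonneg order_trans zero_le_power2)
  then show ?thesis
    using assms closest_point_in_set by (auto simp: inexact_proj_def)
qed

text \<open>
  Started at the Euclidean projection \<open>w\<close> of \<open>y\<close>, the procedure stops at its first test: \<open>w\<close> is itself
  an answer of the oracle, with value \<open>0\<close>. This also covers unbounded \<open>C\<close> and \<open>\<theta> = 0\<close>.
\<close>

lemma closest_point_condG_output:
  assumes "closed C" "convex C" "C \<noteq> {}" "0 \<le> \<theta>" "y \<notin> C"
  shows "condG_output C \<theta> y x (closest_point C y)"
proof -
  define w where "w = closest_point C y"
  have "w \<in> C"
    using closest_point_in_set assms by (auto simp: w_def)
  have "(y - w) \<bullet> (p - w) \<le> 0" if "p \<in> C" for p
    using closest_point_dot[OF \<open>convex C\<close> \<open>closed C\<close> that, of y] by (simp add: w_def)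
  then have "is_arg_min (\<lambda>p. (w - y) \<bullet> (p - w)) (\<lambda>p. p \<in> C) w"
    using \<open>w \<in> C\<close> by (auto simp: is_arg_min_linorder inner_diff_left)
  then show ?thesis
    unfolding condG_output_def w_def[symmetric] using \<open>w \<in> C\<close> \<open>y \<notin> C\<close> \<open>0 \<le> \<theta>\<close>
    by (intro exI[of _ "\<lambda>_. w"] exI[of _ "\<lambda>_. 0"] exI[of _ 0]) auto
qed

section \<open>Broyden's update\<close>

lemma broyden_update_apply:
  "blinfun_apply (broyden_update B s z) h
    = blinfun_apply B h + ((s \<bullet> h) / (norm s)\<^sup>2) *\<^sub>R (z - blinfun_apply B s)"
  by (simp add: broyden_update_def outer_prod_def blinfun.add_left blinfun.scaleR_left
      blinfun_inner_right.rep_eq)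

text \<open>
  The update replaces the error \<open>B - A\<close> by its composition with the orthogonal projection onto the
  complement of \<open>s\<close>, plus the rank-one term that carries the error of the secant condition.
\<close>

lemma broyden_update_norm:
  "norm (broyden_update B s z - A) \<le> norm (B - A) + norm (z - blinfun_apply A s) / norm s"
proof (cases "s = 0")
  case True
  then show ?thesis
    by (simp add: broyden_update_def)
next
  case False
  define c where "c h = (s \<bullet> h) / (norm s)\<^sup>2" for h
  show ?thesis
  proof (rule norm_blinfun_bound)
    fix h
    have "blinfun_apply (broyden_update B s z - A) h
        = blinfun_apply (B - A) (h - c h *\<^sub>R s) + c h *\<^sub>R (z - blinfun_apply A s)"
      by (simp add: broyden_update_apply c_def blinfun.diff_left blinfun.diff_right
          blinfun.scaleR_right algebra_simps)
    also have "norm \<dots> \<le> norm (B - A) * norm (h - c h *\<^sub>R s) + \<bar>c h\<bar> * norm (z - blinfun_apply A s)"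
      by (intro order_trans[OF norm_triangle_ineq] add_mono norm_blinfun) simp
    also have "norm (h - c h *\<^sub>R s) \<le> norm h"
    proof (rule power2_le_imp_le)
      have "(norm (h - c h *\<^sub>R s))\<^sup>2 = (norm h)\<^sup>2 - (s \<bullet> h)\<^sup>2 / (norm s)\<^sup>2"
        using False unfolding c_def power2_norm_eq_inner
        by (simp add: inner_diff_left inner_diff_right inner_commute field_simps power2_eq_square)
      then show "(norm (h - c h *\<^sub>R s))\<^sup>2 \<le> (norm h)\<^sup>2"
        by simp
    qed simp
    also have "\<bar>c h\<bar> \<le> norm h / norm s"
    proof -
      have "\<bar>c h\<bar> \<le> norm s * norm h / (norm s)\<^sup>2"
        using Cauchy_Schwarz_ineq2[of s h] by (simp add: c_def divide_right_mono)
      then show ?thesis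
        using False by (simp add: power2_eq_square)
    qed
    finally show "norm (blinfun_apply (broyden_update B s z - A) h)
        \<le> (norm (B - A) + norm (z - blinfun_apply A s) / norm s) * norm h"
      by (simp add: mult_left_mono mult_right_mono algebra_simps)
  qed simp
qed

definition frobenius_sq :: "('a::euclidean_space \<Rightarrow>\<^sub>L 'b::real_normed_vector) \<Rightarrow> real" where
  "frobenius_sq E = (\<Sum>b\<in>Basis. (norm (blinfun_apply E b))\<^sup>2)"

lemma frobenius_sq_nonneg: "0 \<le> frobenius_sq E"
  by (simp add: frobenius_sq_def sum_nonneg)

text \<open>
  Pythagoras for the Frobenius inner product: the part of \<open>B - A\<close> acting along \<open>s\<close> is exchanged for
  the error of the secant condition.
\<close>

lemma frobenius_sq_broyden_update:
  fixes A B :: "'a::euclidean_space \<Rightarrow>\<^sub>L 'a"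
  assumes "s \<noteq> 0"
  shows "frobenius_sq (broyden_update B s z - A)
    = frobenius_sq (B - A) - (norm (blinfun_apply (B - A) s) / norm s)\<^sup>2
      + (norm (z - blinfun_apply A s) / norm s)\<^sup>2"
proof -
  define E where "E = B - A"
  define w where "w = z - blinfun_apply A s"
  define d where "d = blinfun_apply E s - w"
  define n where "n = (norm s)\<^sup>2"
  have "n \<noteq> 0"
    using assms by (simp add: n_def)
  have "blinfun_apply (broyden_update B s z - A) b = blinfun_apply E b - ((s \<bullet> b) / n) *\<^sub>R d" for b
    by (simp add: broyden_update_apply E_def d_def w_def n_def blinfun.diff_left algebra_simps)
  then have "frobenius_sq (broyden_update B s z - A)
      = (\<Sum>b\<in>Basis. (norm (blinfun_apply E b - ((s \<bullet> b) / n) *\<^sub>R d))\<^sup>2)"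
    by (simp add: frobenius_sq_def)
  also have "\<dots> = (\<Sum>b\<in>Basis. (norm (blinfun_apply E b))\<^sup>2
      - (2 / n) * (((s \<bullet> b) *\<^sub>R blinfun_apply E b) \<bullet> d) + ((norm d)\<^sup>2 / n\<^sup>2) * ((s \<bullet> b) * (s \<bullet> b)))"
    using \<open>n \<noteq> 0\<close> unfolding power2_norm_eq_inner
    by (intro sum.cong refl)
       (simp add: inner_diff_left inner_diff_right inner_commute field_simps power2_eq_square)
  also have "\<dots> = frobenius_sq E
      - (2 / n) * ((\<Sum>b\<in>Basis. (s \<bullet> b) *\<^sub>R blinfun_apply E b) \<bullet> d)
      + ((norm d)\<^sup>2 / n\<^sup>2) * (\<Sum>b\<in>Basis. (s \<bullet> b) * (s \<bullet> b))"
    by (simp add: frobenius_sq_def sum.distrib sum_subtractf sum_distrib_left inner_sum_left)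
  also have "(\<Sum>b\<in>Basis. (s \<bullet> b) *\<^sub>R blinfun_apply E b) = blinfun_apply E s"
    by (simp add: blinfun.scaleR_right[symmetric] blinfun.sum_right[symmetric] euclidean_representation)
  also have "(\<Sum>b\<in>Basis. (s \<bullet> b) * (s \<bullet> b)) = n"
    by (simp add: n_def power2_norm_eq_inner euclidean_inner[symmetric])
  also have "((norm d)\<^sup>2 / n\<^sup>2) * n = (norm d)\<^sup>2 / n"
    using \<open>n \<noteq> 0\<close> by (simp add: power2_eq_square)
  also have "frobenius_sq E - (2 / n) * (blinfun_apply E s \<bullet> d) + (norm d)\<^sup>2 / n
      = frobenius_sq E - (norm (blinfun_apply E s))\<^sup>2 / n + (norm w)\<^sup>2 / n"
    using \<open>n \<noteq> 0\<close> unfolding d_def power2_norm_eq_inner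
    by (simp add: inner_diff_left inner_diff_right inner_commute field_simps)
  finally show ?thesis
    by (simp add: E_def n_def w_def power_divide)
qed

section \<open>A set-valued contraction principle\<close>

text \<open>
  Iterate \<open>p (n + 1) \<in> G\<inverse> (r (p n))\<close>, choosing each time a preimage no farther than \<open>K\<close> times the change
  of the value; the distances decay geometrically with ratio \<open>K * \<mu>\<close>. The condition on \<open>e\<close> keeps the
  iterates in the ball on which the hypotheses hold.
\<close>

lemma set_valued_contraction:
  fixes G :: "'a::banach \<Rightarrow> 'b::real_normed_vector set"
  assumes preimage: "\<And>x u v. x \<in> cball xs e \<Longrightarrow> norm u \<le> \<beta> \<Longrightarrow> v \<in> G x
      \<Longrightarrow> \<exists>p. u \<in> G p \<and> norm (x - p) \<le> K * norm (u - v)"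
    and closed: "\<And>p u p0 u0. (\<And>n. p n \<in> cball xs e) \<Longrightarrow> (\<And>n. u n \<in> G (p n))
      \<Longrightarrow> p \<longlonglongrightarrow> p0 \<Longrightarrow> u \<longlonglongrightarrow> u0 \<Longrightarrow> u0 \<in> G p0"
    and lip: "\<And>y y'. y \<in> cball xs e \<Longrightarrow> y' \<in> cball xs e \<Longrightarrow> norm (r y - r y') \<le> \<mu> * norm (y - y')"
    and small: "\<And>y. y \<in> cball xs e \<Longrightarrow> norm (r y) \<le> \<beta>"
    and "0 \<le> K" "0 \<le> \<mu>" "K * \<mu> < 1"
    and w: "w \<in> G xs" and start: "K * norm (r xs - w) \<le> (1 - K * \<mu>) * e"
  obtains y where "r y \<in> G y" "norm (y - xs) \<le> K * norm (r xs - w) / (1 - K * \<mu>)"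
proof -
  define l where "l = K * \<mu>"
  define d where "d = K * norm (r xs - w)"
  have l: "0 \<le> l" "l < 1" and "0 \<le> d"
    using assms by (auto simp: l_def d_def)
  have "d / (1 - l) \<le> e"
    using start l by (simp add: l_def d_def field_simps)
  have geom: "d * (\<Sum>i<n. l ^ i) \<le> d / (1 - l)" for n
  proof -
    have "(\<Sum>i<n. l ^ i) \<le> (\<Sum>i. l ^ i)"
      using l by (intro sum_le_suminf summable_geometric) auto
    then show ?thesis
      using l \<open>0 \<le> d\<close> by (simp add: suminf_geometric mult_left_mono divide_inverse)
  qed
  \<comment> \<open>A state \<open>s\<close> is a point together with the value at which it was obtained as a preimage.\<close>
  define P where "P n s \<longleftrightarrow> snd s \<in> G (fst s) \<and> norm (fst s - xs) \<le> d * (\<Sum>i<n. l ^ i)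
    \<and> K * norm (r (fst s) - snd s) \<le> l ^ n * d" for n s
  have in_ball: "fst s \<in> cball xs e" if "P n s" for n s
    using that geom[of n] \<open>d / (1 - l) \<le> e\<close> by (simp add: P_def dist_norm norm_minus_commute)
  have "\<exists>s. \<forall>n. P n (s n) \<and>
      (snd (s (Suc n)) = r (fst (s n)) \<and> norm (fst (s (Suc n)) - fst (s n)) \<le> l ^ n * d)"
  proof (rule dependent_nat_choice)
    show "\<exists>s. P 0 s"
      using w by (intro exI[of _ "(xs, w)"]) (simp add: P_def d_def)
  next
    fix s n assume s: "P n s"
    obtain p where p: "r (fst s) \<in> G p" "norm (fst s - p) \<le> K * norm (r (fst s) - snd s)"
      using preimage[OF in_ball[OF s] small[OF in_ball[OF s]]] s unfolding P_def by blast
    have step: "norm (p - fst s) \<le> l ^ n * d"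
      using p s by (simp add: P_def norm_minus_commute)
    have close: "norm (p - xs) \<le> d * (\<Sum>i<Suc n. l ^ i)"
      using step s norm_triangle_ineq[of "p - fst s" "fst s - xs"]
      by (simp add: P_def algebra_simps)
    then have "p \<in> cball xs e"
      using geom[of "Suc n"] \<open>d / (1 - l) \<le> e\<close> by (simp add: dist_norm norm_minus_commute)
    then have "K * norm (r p - r (fst s)) \<le> K * (\<mu> * norm (p - fst s))"
      using lip in_ball[OF s] \<open>0 \<le> K\<close> by (intro mult_left_mono) auto
    then have "K * norm (r p - r (fst s)) \<le> l ^ Suc n * d"
      using mult_left_mono[OF step \<open>0 \<le> l\<close>] unfolding l_def power_Suc mult.assoc by linarith
    then show "\<exists>s'. P (Suc n) s' \<and> (snd s' = r (fst s) \<and> norm (fst s' - fst s) \<le> l ^ n * d)"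
      using p step close unfolding P_def by (intro exI[of _ "(p, r (fst s))"]) simp
  qed
  then obtain s where s: "\<And>n. P n (s n)" "\<And>n. snd (s (Suc n)) = r (fst (s n))"
      "\<And>n. norm (fst (s (Suc n)) - fst (s n)) \<le> l ^ n * d"
    by blast
  define p where "p n = fst (s n)" for n
  have "summable (\<lambda>n. p (Suc n) - p n)"
  proof (rule summable_comparison_test'[where N = 0])
    show "summable (\<lambda>n. l ^ n * d)"
      using l by (intro summable_mult2 summable_geometric) simp
    show "norm (p (Suc n) - p n) \<le> l ^ n * d" for n
      using s(3) by (simp add: p_def)
  qed
  then obtain S where "(\<lambda>n. \<Sum>i<n. p (Suc i) - p i) \<longlonglongrightarrow> S"
    unfolding summable_def sums_def by blast
  then have "(\<lambda>n. p n - p 0) \<longlonglongrightarrow> S"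
    by (simp only: sum_lessThan_telescope)
  then have "(\<lambda>n. p n - p 0 + p 0) \<longlonglongrightarrow> S + p 0"
    by (intro tendsto_intros)
  then obtain y where y: "p \<longlonglongrightarrow> y"
    by auto
  have p_in: "p n \<in> cball xs e" for n
    using in_ball[OF s(1)] by (simp add: p_def)
  then have "y \<in> cball xs e"
    using y closed_cball closed_sequentially by blast
  have "(\<lambda>n. r (p n)) \<longlonglongrightarrow> r y"
  proof (rule Lim_null_comparison[THEN LIM_zero_cancel])
    show "\<forall>\<^sub>F n in sequentially. norm (r (p n) - r y) \<le> \<mu> * norm (p n - y)"
      using lip p_in \<open>y \<in> cball xs e\<close> by simp
    show "(\<lambda>n. \<mu> * norm (p n - y)) \<longlonglongrightarrow> 0"
      using y by (auto intro!: tendsto_eq_intros)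
  qed
  moreover have "r (p n) \<in> G (p (Suc n))" for n
    using s(1)[of "Suc n"] s(2)[of n] by (simp add: P_def p_def)
  ultimately have "r y \<in> G y"
    using closed[of "\<lambda>n. p (Suc n)" "\<lambda>n. r (p n)" y "r y"] p_in LIMSEQ_Suc[OF y] by blast
  moreover have "norm (y - xs) \<le> d / (1 - l)"
  proof (rule Lim_bounded)
    show "(\<lambda>n. norm (p n - xs)) \<longlonglongrightarrow> norm (y - xs)"
      using y by (intro tendsto_intros)
    show "\<forall>n\<ge>0. norm (p n - xs) \<le> d / (1 - l)"
      using s(1) geom by (auto simp: P_def p_def intro: order_trans)
  qed
  ultimately show ?thesis
    using that by (simp add: l_def d_def)
qed

section \<open>Steps of the method near a solution\<close>

text \<open>The error at \<open>y\<close> of the linear model of \<open>f + g\<close> at \<open>x\<close> with slope \<open>T\<close>.\<close>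

definition secant_residual ::
  "('a::real_normed_vector \<Rightarrow> 'a) \<Rightarrow> ('a \<Rightarrow> 'a) \<Rightarrow> ('a \<Rightarrow>\<^sub>L 'a) \<Rightarrow> 'a \<Rightarrow> 'a \<Rightarrow> 'a" where
  "secant_residual f g T x y = f y + g y - (f x + g x) - blinfun_apply T (y - x)"

lemma linearized_inclusion_iff:
  fixes f g :: "'a::real_normed_vector \<Rightarrow> 'a"
  shows "0 \<in> {f x + g x + blinfun_apply T (y - x) + v | v. v \<in> F y}
    \<longleftrightarrow> secant_residual f g T x y \<in> sum_map f g F y"
proof -
  have "secant_residual f g T x y = f y + g y - (f x + g x + blinfun_apply T (y - x))"
    by (simp add: secant_residual_def)
  moreover have "0 = S + v \<longleftrightarrow> q - S = q + v" for q S v :: 'a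
    using neg_eq_iff_add_eq_0[of S v] add_left_cancel[of q "- S" v] by (metis diff_conv_add_uminus)
  ultimately have "0 = f x + g x + blinfun_apply T (y - x) + v
      \<longleftrightarrow> secant_residual f g T x y = f y + g y + v" for v
    by simp
  then show ?thesis
    by (auto simp: sum_map_def)
qed

text \<open>
  The local situation that the convergence analysis needs: \<open>A\<close> stands for the derivative of \<open>f\<close> at \<open>xs\<close>,
  \<open>K\<close> is slightly larger than the regularity constant, and the estimates for \<open>f\<close> and \<open>g\<close> hold on all
  balls of radius \<open>t \<le> R\<close> around \<open>xs\<close> with a constant proportional to \<open>t\<close>.
\<close>

locale secant_broyden_setting =
  fixes \<Omega> C :: "'a::euclidean_space set" and f g :: "'a \<Rightarrow> 'a" and dd :: "'a \<Rightarrow> 'a \<Rightarrow> 'a \<Rightarrow>\<^sub>L 'a"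
    and F :: "'a \<Rightarrow> 'a set" and xs :: 'a and A :: "'a \<Rightarrow>\<^sub>L 'a" and R \<beta> K L c :: real
  assumes pos: "0 < R" "0 < \<beta>" "0 < K" "0 \<le> L" "0 \<le> c"
    and ball: "cball xs R \<subseteq> \<Omega>" and C: "closed C" "convex C" "xs \<in> C"
    and F: "closed (sv_graph UNIV F)"
    and cont: "continuous_on (cball xs R) f" "continuous_on (cball xs R) g"
    and solution: "0 \<in> sum_map f g F xs"
    and preimage: "\<And>x u v. x \<in> cball xs R \<Longrightarrow> norm u \<le> \<beta> \<Longrightarrow> v \<in> sum_map f g F x
      \<Longrightarrow> \<exists>p. u \<in> sum_map f g F p \<and> norm (x - p) \<le> K * norm (u - v)"
    and f_linear: "\<And>t x y. t \<le> R \<Longrightarrow> x \<in> cball xs t \<Longrightarrow> y \<in> cball xs t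
      \<Longrightarrow> norm (f y - f x - blinfun_apply A (y - x)) \<le> L * t * norm (y - x)"
    and g_secant: "\<And>t v w x y. t \<le> R \<Longrightarrow> v \<in> cball xs t \<Longrightarrow> w \<in> cball xs t
      \<Longrightarrow> x \<in> cball xs t \<Longrightarrow> y \<in> cball xs t
      \<Longrightarrow> norm (g y - g x - blinfun_apply (dd v w) (y - x)) \<le> c * t * norm (y - x)"
begin

abbreviation "G \<equiv> sum_map f g F"

lemma sum_map_closed:
  assumes p: "\<And>n. p n \<in> cball xs R" and u: "\<And>n. u n \<in> G (p n)"
    and lim: "p \<longlonglongrightarrow> p0" "u \<longlonglongrightarrow> u0"
  shows "u0 \<in> G p0"
proof -
  have "p0 \<in> cball xs R"
    using closed_sequentially[OF closed_cball p lim(1)] .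
  then have "(\<lambda>n. f (p n)) \<longlonglongrightarrow> f p0" "(\<lambda>n. g (p n)) \<longlonglongrightarrow> g p0"
    using p by (auto intro: continuous_on_tendsto_compose[OF cont(1) lim(1)]
        continuous_on_tendsto_compose[OF cont(2) lim(1)])
  then have "(\<lambda>n. (p n, u n - f (p n) - g (p n))) \<longlonglongrightarrow> (p0, u0 - f p0 - g p0)"
    by (intro tendsto_Pair tendsto_diff lim)
  moreover have "(p n, u n - f (p n) - g (p n)) \<in> sv_graph UNIV F" for n
  proof -
    obtain v where "u n = f (p n) + g (p n) + v" "v \<in> F (p n)"
      using u[of n] unfolding sum_map_def by blast
    then show ?thesis
      by (simp add: sv_graph_def)
  qed
  ultimately have "(p0, u0 - f p0 - g p0) \<in> sv_graph UNIV F"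
    using closed_sequentially[OF F, of "\<lambda>n. (p n, u n - f (p n) - g (p n))"] by simp
  then have "u0 - f p0 - g p0 \<in> F p0" "u0 = f p0 + g p0 + (u0 - f p0 - g p0)"
    by (auto simp: sv_graph_def)
  then show ?thesis
    unfolding sum_map_def by blast
qed

lemma residual_estimate:
  assumes "t \<le> R" "v \<in> cball xs t" "w \<in> cball xs t" "x \<in> cball xs t"
    "y \<in> cball xs t" "y' \<in> cball xs t"
  shows "norm (secant_residual f g (B + dd v w) x y - secant_residual f g (B + dd v w) x y')
    \<le> norm (blinfun_apply (B - A) (y - y')) + (L + c) * t * norm (y - y')"
proof -
  define P where "P = f y - f y' - blinfun_apply A (y - y')"
  define Q where "Q = g y - g y' - blinfun_apply (dd v w) (y - y')"
  define E where "E = blinfun_apply (B - A) (y - y')"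
  have "secant_residual f g (B + dd v w) x y - secant_residual f g (B + dd v w) x y' = P + Q - E"
    by (simp add: secant_residual_def P_def Q_def E_def blinfun.diff_left blinfun.diff_right
        blinfun.add_left)
  also have "norm (P + Q - E) \<le> norm P + norm Q + norm E"
    by (rule order_trans[OF norm_triangle_ineq4 add_right_mono[OF norm_triangle_ineq]])
  finally show ?thesis
    using f_linear[of t y' y] g_secant[of t v w y' y] assms
    unfolding P_def Q_def E_def by (simp add: distrib_right)
qed

lemma residual_lipschitz:
  assumes "t \<le> R" "v \<in> cball xs t" "w \<in> cball xs t" "x \<in> cball xs t"
    "y \<in> cball xs t" "y' \<in> cball xs t"
  shows "norm (secant_residual f g (B + dd v w) x y - secant_residual f g (B + dd v w) x y')
    \<le> (norm (B - A) + (L + c) * t) * norm (y - y')"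
  using residual_estimate[OF assms, of B] norm_blinfun[of "B - A" "y - y'"]
  by (simp add: algebra_simps)

lemma residual_small:
  assumes "t \<le> R" "t \<le> K * \<beta>" "K * (norm (B - A) + (L + c) * t) \<le> 1 / 2"
    "v \<in> cball xs t" "x \<in> cball xs t" "y \<in> cball xs t"
  shows "norm (secant_residual f g (B + dd v x) x y) \<le> \<beta>"
proof -
  have "0 \<le> t"
    using assms(5) by (metis mem_cball order_trans zero_le_dist)
  have "norm (secant_residual f g (B + dd v x) x y) \<le> (norm (B - A) + (L + c) * t) * norm (y - x)"
    using residual_lipschitz[of t v x x y x B] assms by (simp add: secant_residual_def)
  also have "\<dots> \<le> 1 / (2 * K) * (2 * t)"
  proof (rule mult_mono)
    show "norm (B - A) + (L + c) * t \<le> 1 / (2 * K)"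
      using assms pos by (simp add: field_simps)
    show "norm (y - x) \<le> 2 * t"
      using assms dist_triangle2[of y x xs] by (simp add: dist_norm norm_minus_commute)
  qed (use pos in auto)
  also have "\<dots> \<le> \<beta>"
    using assms pos by (simp add: field_simps)
  finally show ?thesis .
qed

text \<open>
  The residual vanishes at \<open>x\<close>, so its value at \<open>xs\<close>, where the iteration starts, is at most its
  Lipschitz constant times \<open>norm (x - xs)\<close>. The fixed point is sought in the ball around \<open>xs\<close> through
  \<open>x\<close>, which is large enough because \<open>l \<le> 1 - l\<close>.
\<close>

lemma step_exists:
  assumes "t \<le> R" "t \<le> K * \<beta>" "K * (norm (B - A) + (L + c) * t) \<le> l" "l < 1 / 2"
    "v \<in> cball xs t" "x \<in> cball xs t"
  shows "\<exists>y. secant_residual f g (B + dd v x) x y \<in> G y \<and> norm (y - xs) \<le> l / (1 - l) * norm (x - xs)"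
proof -
  define \<mu> where "\<mu> = norm (B - A) + (L + c) * t"
  define e where "e = norm (x - xs)"
  define r where "r = secant_residual f g (B + dd v x) x"
  have "0 \<le> t"
    using assms(6) by (metis mem_cball order_trans zero_le_dist)
  then have \<mu>: "0 \<le> \<mu>" "0 \<le> K * \<mu>" "K * \<mu> \<le> l" "K * \<mu> < 1 / 2"
    using assms pos by (auto simp: \<mu>_def)
  have "e \<le> t"
    using assms by (simp add: e_def dist_norm norm_minus_commute)
  then have in_t: "p \<in> cball xs t" if "p \<in> cball xs e" for p
    using that by auto
  have lip: "norm (r y - r y') \<le> \<mu> * norm (y - y')" if "y \<in> cball xs t" "y' \<in> cball xs t" for y y'
    using residual_lipschitz[of t v x x y y' B] assms that by (simp add: r_def \<mu>_def)
  have "r x = 0"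
    by (simp add: r_def secant_residual_def)
  have "norm (r xs) \<le> \<mu> * e"
    using lip[of xs x] assms \<open>0 \<le> t\<close> \<open>r x = 0\<close> by (simp add: e_def norm_minus_commute)
  then have d: "K * norm (r xs - 0) \<le> K * \<mu> * e"
    using pos by simp
  have start: "K * norm (r xs - 0) \<le> (1 - K * \<mu>) * e"
    using d mult_right_mono[of "K * \<mu>" "1 - K * \<mu>" e] \<mu> by (simp add: e_def)
  obtain y where y: "r y \<in> G y" "norm (y - xs) \<le> K * norm (r xs - 0) / (1 - K * \<mu>)"
  proof (rule set_valued_contraction[where G = G and r = r and e = e and xs = xs and w = 0
        and K = K and \<mu> = \<mu> and \<beta> = \<beta>])
    show "\<exists>p. u \<in> G p \<and> norm (y - p) \<le> K * norm (u - w)"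
      if "y \<in> cball xs e" "norm u \<le> \<beta>" "w \<in> G y" for y u w
      using preimage that \<open>e \<le> t\<close> \<open>t \<le> R\<close> by auto
    show "u0 \<in> G p0" if "\<And>n. p n \<in> cball xs e" "\<And>n. u n \<in> G (p n)" "p \<longlonglongrightarrow> p0" "u \<longlonglongrightarrow> u0" for p u p0 u0
      using sum_map_closed[of p u] that \<open>e \<le> t\<close> \<open>t \<le> R\<close> by (meson mem_cball order_trans)
    show "norm (r y) \<le> \<beta>" if "y \<in> cball xs e" for y
      unfolding r_def using residual_small[of t B v x y] assms in_t[OF that] by simp
  qed (use lip in_t start \<mu> pos solution in auto)
  have "K * norm (r xs - 0) / (1 - K * \<mu>) \<le> K * \<mu> * e / (1 - K * \<mu>)"
    using d \<mu> by (intro divide_right_mono) auto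
  also have "\<dots> = K * \<mu> / (1 - K * \<mu>) * e"
    by simp
  also have "\<dots> \<le> l / (1 - l) * e"
    using \<mu> assms by (intro mult_right_mono frac_le) (auto simp: e_def)
  finally show ?thesis
    using y unfolding r_def e_def by fastforce
qed

lemma broyden_deterioration:
  assumes "t \<le> R" "x \<in> cball xs t" "y \<in> cball xs t"
  shows "norm (f y - f x - blinfun_apply A (y - x)) / norm (y - x) \<le> L * t"
    and "norm (broyden_update B (y - x) (f y - f x) - A) \<le> norm (B - A) + L * t"
proof -
  have "0 \<le> t"
    using assms(2) by (metis mem_cball order_trans zero_le_dist)
  then show "norm (f y - f x - blinfun_apply A (y - x)) / norm (y - x) \<le> L * t"
    using f_linear[OF assms] pos by (cases "x = y") (auto simp: divide_le_eq)
  then show "norm (broyden_update B (y - x) (f y - f x) - A) \<le> norm (B - A) + L * t"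
    using broyden_update_norm[of B "y - x" "f y - f x" A] by linarith
qed

section \<open>Existence of a linearly convergent run\<close>

text \<open>
  The factor \<open>1 / (1 - q)\<close> in the hypothesis on \<open>B0\<close> sums the geometric series of the errors, each of
  which contributes \<open>L\<close> times itself to the deterioration of \<open>B\<close>.
\<close>

lemma run_exists:
  assumes \<tau>: "0 < \<tau>" "\<tau> \<le> R" "\<tau> \<le> K * \<beta>" and l: "0 \<le> l" "l < 1 / 2" and q: "q = l / (1 - l)"
    and B0: "K * (norm (B0 - A) + L * \<tau> / (1 - q) + (L + c) * \<tau>) \<le> l"
    and \<theta>: "\<And>k. 0 \<le> \<theta> k"
    and xm: "xm \<in> cball xs \<tau> \<inter> C" and x0: "x0 \<in> cball xs \<tau> \<inter> C"
  shows "\<exists>P N x y B. broyden_secant_run \<Omega> C f g dd F \<theta> P xm x0 B0 N x y B \<and> run_within xs \<tau> C N x y \<and>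
    (N = \<infinity> \<longrightarrow> (\<forall>k. x k \<noteq> xs \<and> x (Suc k) \<noteq> x k) \<and> q_linearly_convergent x xs)"
proof -
  have q01: "0 \<le> q" "q < 1"
    using l by (auto simp: q)
  define Y where "Y v x B = (SOME y. secant_residual f g (B + dd v x) x y \<in> G y
    \<and> norm (y - xs) \<le> q * norm (x - xs))" for v x B
  have Y: "secant_residual f g (B + dd v x) x (Y v x B) \<in> G (Y v x B)
      \<and> norm (Y v x B - xs) \<le> q * norm (x - xs)"
    if "v \<in> cball xs \<tau>" "x \<in> cball xs \<tau>" "K * (norm (B - A) + (L + c) * \<tau>) \<le> l" for v x B
    unfolding Y_def using step_exists[OF \<tau>(2,3) that(3) l(2) that(1,2)] unfolding q by (rule someI_ex)
  \<comment> \<open>The state consists of the previous iterate, the current iterate and the current operator.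
    The recursion ignores the stopping test, since a step exists regardless of it; the test only
    determines \<open>N\<close>.\<close>
  define S where "S = rec_nat (xm, x0, B0) (\<lambda>_ (v, x, B).
    (x, closest_point C (Y v x B), broyden_update B (Y v x B - x) (f (Y v x B) - f x)))"
  define v where "v k = fst (S k)" for k
  define x where "x k = fst (snd (S k))" for k
  define B where "B k = snd (snd (S k))" for k
  define y where "y k = Y (v k) (x k) (B k)" for k
  have zero: "v 0 = xm" "x 0 = x0" "B 0 = B0"
    by (simp_all add: S_def v_def x_def B_def)
  have suc: "v (Suc k) = x k" "x (Suc k) = closest_point C (y k)"
      "B (Suc k) = broyden_update (B k) (y k - x k) (f (y k) - f (x k))" for k
    by (simp_all add: S_def v_def x_def B_def y_def case_prod_beta)
  have v_eq: "v k = (case k of 0 \<Rightarrow> xm | Suc j \<Rightarrow> x j)" for k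
    by (cases k) (simp_all add: zero suc)
  have "C \<noteq> {}"
    using C by auto
  have geom: "L * (\<tau> * (\<Sum>i<k. q ^ i)) \<le> L * \<tau> / (1 - q)" for k
  proof -
    have "(\<Sum>i<k. q ^ i) \<le> 1 / (1 - q)"
      using q01 sum_le_suminf[OF summable_geometric, of q "{..<k}"] by (simp add: suminf_geometric)
    then have "L * \<tau> * (\<Sum>i<k. q ^ i) \<le> L * \<tau> * (1 / (1 - q))"
      using pos \<tau> by (intro mult_left_mono) auto
    then show ?thesis
      by (simp add: mult.assoc)
  qed
  have step: "secant_residual f g (B k + dd (v k) (x k)) (x k) (y k) \<in> G (y k)"
      "norm (y k - xs) \<le> q * norm (x k - xs)"
    if "v k \<in> cball xs \<tau>" "x k \<in> cball xs \<tau>"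
      "norm (B k - A) \<le> norm (B0 - A) + L * (\<tau> * (\<Sum>i<k. q ^ i))" for k
  proof -
    have "norm (B k - A) \<le> norm (B0 - A) + L * \<tau> / (1 - q)"
      using geom[of k] that by linarith
    then have "K * (norm (B k - A) + (L + c) * \<tau>) \<le> K * (norm (B0 - A) + L * \<tau> / (1 - q) + (L + c) * \<tau>)"
      using pos by (intro mult_left_mono) auto
    then have "K * (norm (B k - A) + (L + c) * \<tau>) \<le> l"
      using B0 by linarith
    then show "secant_residual f g (B k + dd (v k) (x k)) (x k) (y k) \<in> G (y k)"
      "norm (y k - xs) \<le> q * norm (x k - xs)"
      using Y that by (auto simp: y_def)
  qed
  have inv: "v k \<in> cball xs \<tau> \<and> x k \<in> C \<and> norm (x k - xs) \<le> q ^ k * \<tau> \<and> x k \<in> cball xs \<tau> \<and>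
      norm (B k - A) \<le> norm (B0 - A) + L * (\<tau> * (\<Sum>i<k. q ^ i)) \<and>
      norm (x (Suc k) - xs) \<le> q * norm (x k - xs)" for k
  proof -
    have close: "norm (x (Suc k) - xs) \<le> norm (y k - xs)" for k
      using closest_point_lipschitz[OF C(2,1) \<open>C \<noteq> {}\<close>, of "y k" xs] C(3)
      by (simp add: suc closest_point_self dist_norm)
    show ?thesis
    proof (induction k)
      case 0
      have "x 0 \<in> cball xs \<tau>" "x 0 \<in> C" "v 0 \<in> cball xs \<tau>"
        using xm x0 by (auto simp: zero)
      moreover have "norm (B 0 - A) \<le> norm (B0 - A) + L * (\<tau> * (\<Sum>i<0. q ^ i))"
        by (simp add: zero)
      ultimately show ?case
        using step(2)[of 0] close[of 0] by (auto simp: dist_norm norm_minus_commute)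
    next
      case (Suc k)
      define t where "t = norm (x k - xs)"
      have y_near: "norm (y k - xs) \<le> t"
        using step(2)[of k] Suc q01 mult_left_le_one_le[of t q] by (auto simp: t_def)
      have t: "t \<le> q ^ k * \<tau>" "t \<le> \<tau>"
        using Suc by (auto simp: t_def dist_norm norm_minus_commute)
      have "norm (B (Suc k) - A) \<le> norm (B k - A) + L * t"
        unfolding suc using t \<tau> y_near
        by (intro broyden_deterioration(2)) (auto simp: t_def dist_norm norm_minus_commute)
      also have "\<dots> \<le> norm (B0 - A) + L * (\<tau> * (\<Sum>i<k. q ^ i)) + L * (q ^ k * \<tau>)"
        using Suc t pos by (intro add_mono mult_left_mono) auto
      finally have "norm (B (Suc k) - A) \<le> norm (B0 - A) + L * (\<tau> * (\<Sum>i<Suc k. q ^ i))"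
        by (simp add: algebra_simps)
      moreover have "norm (x (Suc k) - xs) \<le> q ^ Suc k * \<tau>"
      proof -
        have "q * t \<le> q * (q ^ k * \<tau>)"
          using t q01 by (intro mult_left_mono) auto
        then show ?thesis
          using Suc by (auto simp: t_def mult.assoc)
      qed
      moreover have "x (Suc k) \<in> cball xs \<tau>"
        using close[of k] y_near t by (simp add: dist_norm norm_minus_commute)
      moreover have "v (Suc k) \<in> cball xs \<tau>" "x (Suc k) \<in> C"
        using Suc closest_point_in_set[OF C(1) \<open>C \<noteq> {}\<close>] by (auto simp: suc)
      ultimately show ?case
        using step(2)[of "Suc k"] close[of "Suc k"] by linarith
    qed
  qed
  have y_in: "y k \<in> cball xs \<tau>" for k
  proof -
    have "norm (y k - xs) \<le> norm (x k - xs)"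
      using step(2)[of k] inv[of k] q01 mult_left_le_one_le[of "norm (x k - xs)" q] by auto
    then show ?thesis
      using inv[of k] by (simp add: dist_norm norm_minus_commute)
  qed
  define N where "N = (if \<exists>m. 0 \<in> G (x m) then enat (LEAST m. 0 \<in> G (x m)) else \<infinity>)"
  have before: "0 \<notin> G (x k)" if "enat k < N" for k
    using that not_less_Least by (fastforce simp: N_def split: if_splits)
  have at_N: "0 \<in> G (x m)" if "N = enat m" for m
    using that LeastI_ex[of "\<lambda>m. 0 \<in> G (x m)"] by (auto simp: N_def split: if_splits)
  define P where "P = (\<lambda>(k::nat) p (u::'a). closest_point C p)"
  have "broyden_secant_run \<Omega> C f g dd F \<theta> P xm x0 B0 N x y B"
    unfolding broyden_secant_run_def
  proof (intro conjI allI impI)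
    fix k assume k: "enat k < N"
    show "0 \<notin> G (x k)"
      using before k by blast
    show "y k \<in> \<Omega>"
      using y_in[of k] ball \<tau> by auto
    show "0 \<in> {f (x k) + g (x k)
        + blinfun_apply (B k + dd (case k of 0 \<Rightarrow> xm | Suc j \<Rightarrow> x j) (x k)) (y k - x k)
        + v | v. v \<in> F (y k)}"
      unfolding linearized_inclusion_iff v_eq[symmetric] using step(1) inv by blast
    show "B (Suc k) = broyden_update (B k) (y k - x k) (f (y k) - f (x k))"
      by (rule suc)
    show "if y k \<in> C then x (Suc k) = y k
      else x (Suc k) = P k (y k) (x k) \<and> x (Suc k) \<in> inexact_proj C (y k) (x k) (\<theta> k) \<and>
        condG_output C (\<theta> k) (y k) (x k) (x (Suc k))"
      using closest_point_inexact_proj[OF C(1,2) \<open>C \<noteq> {}\<close> \<theta>]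
        closest_point_condG_output[OF C(1,2) \<open>C \<noteq> {}\<close> \<theta>]
      by (simp add: suc P_def closest_point_self)
  qed (use xm x0 zero at_N in auto)
  moreover have "run_within xs \<tau> C N x y"
    using inv y_in by (auto simp: run_within_def)
  moreover have "(\<forall>k. x k \<noteq> xs \<and> x (Suc k) \<noteq> x k) \<and> q_linearly_convergent x xs" if "N = \<infinity>"
  proof (intro conjI allI)
    fix k
    have "0 \<notin> G (x k)"
      using before that by simp
    then show "x k \<noteq> xs"
      using solution by metis
    then have "q * norm (x k - xs) < norm (x k - xs)"
      using q01 by simp
    then show "x (Suc k) \<noteq> x k"
      using inv[of k] by auto
  next
    have "(\<lambda>k. q ^ k * \<tau>) \<longlonglongrightarrow> 0"
      using q01 by (auto intro!: tendsto_mult_left_zero LIMSEQ_realpow_zero)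
    then have "(\<lambda>k. x k - xs) \<longlonglongrightarrow> 0"
      by (rule Lim_null_comparison[rotated]) (use inv in auto)
    then have "x \<longlonglongrightarrow> xs"
      by (rule LIM_zero_cancel)
    moreover have "norm (x (Suc k) - xs) \<le> max q (1 / 2) * norm (x k - xs)" for k
      using inv[of k] mult_right_mono[of q "max q (1 / 2)" "norm (x k - xs)"] by (auto intro: order_trans)
    ultimately show "q_linearly_convergent x xs"
      unfolding q_linearly_convergent_def using q01 by (intro conjI exI[of _ "max q (1 / 2)"]) auto
  qed
  ultimately show ?thesis
    by blast
qed

lemma run_exists_eventually:
  assumes B0: "K * norm (B0 - A) < 1 / 2" and \<theta>: "\<And>k. 0 \<le> \<theta> k"
  shows "\<forall>\<^sub>F \<tau> in at_right 0. \<forall>xm \<in> cball xs \<tau> \<inter> C. \<forall>x0 \<in> cball xs \<tau> \<inter> C. \<exists>P N x y B.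
    broyden_secant_run \<Omega> C f g dd F \<theta> P xm x0 B0 N x y B \<and> run_within xs \<tau> C N x y \<and>
    (N = \<infinity> \<longrightarrow> (\<forall>k. x k \<noteq> xs \<and> x (Suc k) \<noteq> x k) \<and> q_linearly_convergent x xs)"
proof -
  obtain l where l: "K * norm (B0 - A) < l" "l < 1 / 2"
    using dense B0 by blast
  then have "0 \<le> l"
    using pos by (smt (verit) mult_nonneg_nonneg norm_ge_zero)
  define q where "q = l / (1 - l)"
  have "((\<lambda>\<tau>. K * (norm (B0 - A) + L * \<tau> / (1 - q) + (L + c) * \<tau>)) \<longlongrightarrow>
      K * (norm (B0 - A) + L * 0 / (1 - q) + (L + c) * 0)) (at_right 0)"
    by (cases "1 - q = 0") (auto intro!: tendsto_eq_intros)
  then have "\<forall>\<^sub>F \<tau> in at_right 0. K * (norm (B0 - A) + L * \<tau> / (1 - q) + (L + c) * \<tau>) < l"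
    using l by (intro order_tendstoD(2)) auto
  moreover have "\<forall>\<^sub>F \<tau> in at_right 0. 0 < \<tau> \<and> \<tau> < min R (K * \<beta>)"
    using pos by (intro eventually_at_rightI[of 0 "min R (K * \<beta>)"]) auto
  ultimately show ?thesis
  proof eventually_elim
    case (elim \<tau>)
    then show ?case
      using run_exists[OF _ _ _ \<open>0 \<le> l\<close> l(2) q_def, of \<tau> B0 \<theta>] \<theta> by auto
  qed
qed

end

section \<open>Decay by a Lyapunov function\<close>

text \<open>
  The quantity \<open>e k * exp (c * \<phi> k)\<close> decays by the factor \<open>\<rho>'\<close> in every step. The constant \<open>c\<close> is such
  that \<open>\<rho> * exp (c * \<epsilon>\<^sup>2) = 3\<close>; hence \<open>e (k + 1) \<le> \<rho> * exp (c * (\<sigma> k)\<^sup>2) * e k\<close> in both the good and the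
  bad case, and the drop of \<open>\<phi>\<close> by \<open>(\<sigma> k)\<^sup>2\<close> cancels the exponential. The step estimates are only
  available while \<open>d k \<le> D\<close>, which is maintained along the induction because the errors are summable.
\<close>

lemma lyapunov_decay:
  fixes e \<sigma> \<phi> d :: "nat \<Rightarrow> real"
  assumes nonneg: "\<And>k. 0 \<le> e k" "\<And>k. 0 \<le> \<phi> k" "\<And>k. 0 \<le> \<sigma> k"
    and const: "0 < \<rho>" "\<rho> < 1" "0 < \<epsilon>" "0 \<le> L" "0 \<le> \<tau>" "\<rho>' < 1"
    and e_le: "\<And>k. k \<le> n \<Longrightarrow> e k \<le> \<tau>"
    and d: "\<And>k. k < n \<Longrightarrow> d k \<le> D \<Longrightarrow> d (Suc k) \<le> d k + L * e k"
    and \<phi>: "\<And>k. k < n \<Longrightarrow> d k \<le> D \<Longrightarrow> \<phi> (Suc k) \<le> \<phi> k - (\<sigma> k)\<^sup>2 + (L * e k)\<^sup>2"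
    and bad: "\<And>k. k < n \<Longrightarrow> d k \<le> D \<Longrightarrow> e (Suc k) \<le> 3 * e k"
    and good: "\<And>k. k < n \<Longrightarrow> d k \<le> D \<Longrightarrow> \<sigma> k \<le> \<epsilon> \<Longrightarrow> e (Suc k) \<le> \<rho> * e k"
    and c: "c = ln (3 / \<rho>) / \<epsilon>\<^sup>2"
    and \<rho>': "\<rho> * exp (c * (L * \<tau>)\<^sup>2) \<le> \<rho>'"
    and D: "d 0 + L * \<tau> * exp (c * \<phi> 0) / (1 - \<rho>') \<le> D"
    and "k \<le> n"
  shows "e k \<le> \<rho>' ^ k * (\<tau> * exp (c * \<phi> 0))" and "d k \<le> D"
proof -
  have "0 \<le> c"
    using const by (simp add: c)
  have "0 < \<rho>'"
    using \<rho>' const by (smt (verit) exp_gt_zero mult_pos_pos)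
  define V where "V = \<tau> * exp (c * \<phi> 0)"
  have "0 \<le> V"
    using const by (simp add: V_def)
  have geom: "d 0 + L * (V * (\<Sum>i<k. \<rho>' ^ i)) \<le> D" for k
  proof -
    have "(\<Sum>i<k. \<rho>' ^ i) \<le> 1 / (1 - \<rho>')"
      using \<open>0 < \<rho>'\<close> const sum_le_suminf[OF summable_geometric, of \<rho>' "{..<k}"]
      by (simp add: suminf_geometric)
    then have "L * V * (\<Sum>i<k. \<rho>' ^ i) \<le> L * V * (1 / (1 - \<rho>'))"
      using const \<open>0 \<le> V\<close> by (intro mult_left_mono) auto
    then show ?thesis
      using D by (simp add: V_def mult.assoc)
  qed
  have le_V: "e k \<le> e k * exp (c * \<phi> k)" for k
    using nonneg[of k] \<open>0 \<le> c\<close> mult_left_mono[of 1 "exp (c * \<phi> k)" "e k"] by simp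
  have "e k * exp (c * \<phi> k) \<le> \<rho>' ^ k * V \<and> d k \<le> d 0 + L * (V * (\<Sum>i<k. \<rho>' ^ i))"
    using \<open>k \<le> n\<close>
  proof (induction k)
    case 0
    then show ?case
      using e_le[of 0] by (simp add: V_def)
  next
    case (Suc k)
    then have k: "k < n" "e k * exp (c * \<phi> k) \<le> \<rho>' ^ k * V"
        "d k \<le> d 0 + L * (V * (\<Sum>i<k. \<rho>' ^ i))"
      by auto
    then have dk: "d k \<le> D"
      using geom[of k] by linarith
    have growth: "e (Suc k) \<le> \<rho> * exp (c * (\<sigma> k)\<^sup>2) * e k"
    proof (cases "\<sigma> k \<le> \<epsilon>")
      case True
      have "\<rho> * 1 * e k \<le> \<rho> * exp (c * (\<sigma> k)\<^sup>2) * e k"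
        using const nonneg \<open>0 \<le> c\<close> by (intro mult_right_mono mult_left_mono) auto
      then show ?thesis
        using good[OF k(1) dk True] by linarith
    next
      case False
      have "\<rho> * exp (c * \<epsilon>\<^sup>2) = 3"
        using const by (simp add: c)
      moreover have "\<rho> * exp (c * \<epsilon>\<^sup>2) * e k \<le> \<rho> * exp (c * (\<sigma> k)\<^sup>2) * e k"
        using const nonneg \<open>0 \<le> c\<close> False
        by (intro mult_right_mono mult_left_mono) (auto intro!: mult_left_mono power_mono)
      ultimately show ?thesis
        using bad[OF k(1) dk] by simp
    qed
    have drop: "c * (\<sigma> k)\<^sup>2 + c * \<phi> (Suc k) \<le> c * (L * \<tau>)\<^sup>2 + c * \<phi> k"
    proof -
      have "(L * e k)\<^sup>2 \<le> (L * \<tau>)\<^sup>2"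
        using e_le[of k] k const nonneg by (intro power_mono mult_left_mono) auto
      then have "(\<sigma> k)\<^sup>2 + \<phi> (Suc k) \<le> (L * \<tau>)\<^sup>2 + \<phi> k"
        using \<phi>[OF k(1) dk] by linarith
      then show ?thesis
        using \<open>0 \<le> c\<close> mult_left_mono by (fastforce simp: distrib_left[symmetric])
    qed
    have "e (Suc k) * exp (c * \<phi> (Suc k)) \<le> \<rho> * exp (c * (\<sigma> k)\<^sup>2) * e k * exp (c * \<phi> (Suc k))"
      using growth by (intro mult_right_mono) auto
    also have "\<dots> = \<rho> * e k * exp (c * (\<sigma> k)\<^sup>2 + c * \<phi> (Suc k))"
      by (simp add: exp_add)
    also have "\<dots> \<le> \<rho> * e k * exp (c * (L * \<tau>)\<^sup>2 + c * \<phi> k)"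
      using drop const nonneg by (intro mult_left_mono) auto
    also have "\<dots> = (\<rho> * exp (c * (L * \<tau>)\<^sup>2)) * (e k * exp (c * \<phi> k))"
      by (simp add: exp_add)
    also have "\<dots> \<le> \<rho>' * (\<rho>' ^ k * V)"
      by (rule mult_mono) (use \<rho>' k \<open>0 < \<rho>'\<close> nonneg in auto)
    finally have "e (Suc k) * exp (c * \<phi> (Suc k)) \<le> \<rho>' ^ Suc k * V"
      by simp
    moreover have "L * e k \<le> L * (\<rho>' ^ k * V)"
      using le_V[of k] k const by (intro mult_left_mono) auto
    then have "d (Suc k) \<le> d 0 + L * (V * (\<Sum>i<Suc k. \<rho>' ^ i))"
      using d[OF k(1) dk] k(3) by (simp add: algebra_simps)
    ultimately show ?case
      by simp
  qed
  then show "e k \<le> \<rho>' ^ k * (\<tau> * exp (c * \<phi> 0))" "d k \<le> D"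
    using le_V[of k] geom[of k] by (auto simp: V_def)
qed

lemma tendsto_zero_of_telescoping:
  fixes s r \<phi> :: "nat \<Rightarrow> real"
  assumes "\<And>k. 0 \<le> \<phi> k" "\<And>k. 0 \<le> s k" "\<And>k. 0 \<le> r k" "summable r"
    and step: "\<And>k. \<phi> (Suc k) \<le> \<phi> k - s k + r k"
  shows "s \<longlonglongrightarrow> 0"
proof -
  have telescope: "(\<Sum>k<n. s k) + \<phi> n \<le> \<phi> 0 + (\<Sum>k<n. r k)" for n
  proof (induction n)
    case (Suc n)
    then show ?case
      using step[of n] by simp
  qed simp
  have "(\<Sum>k<n. s k) \<le> \<phi> 0 + suminf r" for n
  proof -
    have "(\<Sum>k<n. r k) \<le> suminf r"
      using assms by (intro sum_le_suminf) auto
    then show ?thesis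
      using telescope[of n] assms(1)[of n] by linarith
  qed
  then have "summable s"
    using assms by (intro summableI_nonneg_bounded)
  then show ?thesis
    by (rule summable_LIMSEQ_zero)
qed

section \<open>Convergence of every run and uniqueness under strong regularity\<close>

text \<open>
  With \<open>norm (y - p) \<le> q * e\<close> for \<open>e = norm (x - p)\<close>, the square of the new error is at most
  \<open>(q\<^sup>2 + 2 * \<Theta> * (1 + q)\<^sup>2) * e\<^sup>2\<close>. The factor is below 9 for \<open>q = 1\<close>. For \<open>q \<le> 1\<close> it is at most
  \<open>2 * \<Theta> + 4 * q\<close>, and \<open>q = (1 - 2 * \<Theta>) / 8\<close> puts this halfway between \<open>2 * \<Theta>\<close> and \<open>1\<close>.
\<close>

lemma inexact_step:
  assumes x': "x' = y \<or> x' \<in> inexact_proj C y x \<theta>" and "p \<in> C"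
    and \<theta>: "0 \<le> \<theta>" "\<theta> \<le> \<Theta>" "\<Theta> < 1 / 2"
  shows "norm (y - p) \<le> norm (x - p) \<Longrightarrow> norm (x' - p) \<le> 3 * norm (x - p)"
    and "norm (y - p) \<le> (1 - 2 * \<Theta>) / 8 * norm (x - p)
      \<Longrightarrow> norm (x' - p) \<le> sqrt (1 / 2 + \<Theta>) * norm (x - p)"
proof -
  define e where "e = norm (x - p)"
  have sq: "(norm (x' - p))\<^sup>2 \<le> (q\<^sup>2 + 2 * \<Theta> * (1 + q)\<^sup>2) * e\<^sup>2"
    if q: "norm (y - p) \<le> q * e" "0 \<le> q" for q
  proof -
    have "norm (y - x) \<le> (1 + q) * e"
      using norm_triangle_ineq4[of "y - p" "x - p"] q by (simp add: e_def algebra_simps)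
    then have "(norm (y - x))\<^sup>2 \<le> ((1 + q) * e)\<^sup>2"
      by (intro power_mono) auto
    then have "2 * \<theta> * (norm (y - x))\<^sup>2 \<le> 2 * \<Theta> * ((1 + q) * e)\<^sup>2"
      using \<theta> by (intro mult_mono) auto
    moreover have "(norm (y - p))\<^sup>2 \<le> (q * e)\<^sup>2"
      using q by (intro power_mono) auto
    moreover have "0 \<le> 2 * \<theta> * (norm (y - x))\<^sup>2"
      using \<theta> by simp
    then have "(norm (x' - p))\<^sup>2 \<le> (norm (y - p))\<^sup>2 + 2 * \<theta> * (norm (y - x))\<^sup>2"
      using x' inexact_proj_dist[OF _ \<open>p \<in> C\<close>] by auto
    moreover have "(q\<^sup>2 + 2 * \<Theta> * (1 + q)\<^sup>2) * e\<^sup>2 = (q * e)\<^sup>2 + 2 * \<Theta> * ((1 + q) * e)\<^sup>2"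
      unfolding power_mult_distrib by (simp add: distrib_right)
    ultimately show ?thesis
      by linarith
  qed
  have "0 \<le> \<Theta>"
    using \<theta> by linarith
  show "norm (x' - p) \<le> 3 * norm (x - p)" if "norm (y - p) \<le> norm (x - p)"
  proof (rule power2_le_imp_le)
    have "(norm (x' - p))\<^sup>2 \<le> (1\<^sup>2 + 2 * \<Theta> * (1 + 1)\<^sup>2) * e\<^sup>2"
      using that by (intro sq) (auto simp: e_def)
    also have "\<dots> \<le> 9 * e\<^sup>2"
      using \<theta> by (intro mult_right_mono) auto
    finally show "(norm (x' - p))\<^sup>2 \<le> (3 * norm (x - p))\<^sup>2"
      by (simp add: e_def power_mult_distrib)
  qed simp
  show "norm (x' - p) \<le> sqrt (1 / 2 + \<Theta>) * norm (x - p)"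
    if "norm (y - p) \<le> (1 - 2 * \<Theta>) / 8 * norm (x - p)"
  proof (rule power2_le_imp_le)
    define q where "q = (1 - 2 * \<Theta>) / 8"
    have q: "0 \<le> q" "q \<le> 1"
      using \<theta> \<open>0 \<le> \<Theta>\<close> by (auto simp: q_def)
    then have "q * q \<le> q"
      by (simp add: mult_left_le)
    have "(norm (x' - p))\<^sup>2 \<le> (q\<^sup>2 + 2 * \<Theta> * (1 + q)\<^sup>2) * e\<^sup>2"
      using that q by (intro sq) (auto simp: q_def e_def)
    also have "\<dots> \<le> (1 / 2 + \<Theta>) * e\<^sup>2"
    proof (rule mult_right_mono)
      have "2 * \<Theta> * (2 * q + q * q) \<le> 1 * (2 * q + q * q)"
        using \<theta> q by (intro mult_right_mono) auto
      then have "q\<^sup>2 + 2 * \<Theta> * (1 + q)\<^sup>2 \<le> 2 * \<Theta> + 4 * q"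
        using \<open>q * q \<le> q\<close> by (simp add: power2_eq_square algebra_simps)
      moreover have "2 * \<Theta> + 4 * q = 1 / 2 + \<Theta>"
        by (simp add: q_def field_simps)
      ultimately show "q\<^sup>2 + 2 * \<Theta> * (1 + q)\<^sup>2 \<le> 1 / 2 + \<Theta>"
        by linarith
    qed simp
    finally show "(norm (x' - p))\<^sup>2 \<le> (sqrt (1 / 2 + \<Theta>) * norm (x - p))\<^sup>2"
      using \<open>0 \<le> \<Theta>\<close> by (simp add: e_def power_mult_distrib)
  qed (use \<open>0 \<le> \<Theta>\<close> in simp)
qed

lemma run_stepD:
  assumes run: "broyden_secant_run \<Omega> C f g dd F \<theta> P xm x0 B0 N x y B" and k: "enat k < N"
  shows "0 \<notin> sum_map f g F (x k)"
    and "secant_residual f g (B k + dd (case k of 0 \<Rightarrow> xm | Suc j \<Rightarrow> x j) (x k)) (x k) (y k)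
      \<in> sum_map f g F (y k)"
    and "B (Suc k) = broyden_update (B k) (y k - x k) (f (y k) - f (x k))"
    and "x (Suc k) = y k \<or> x (Suc k) \<in> inexact_proj C (y k) (x k) (\<theta> k)"
    and "x (Suc k) = (if y k \<in> C then y k else P k (y k) (x k))"
proof -
  have *: "0 \<notin> sum_map f g F (x k) \<and> y k \<in> \<Omega> \<and>
      0 \<in> {f (x k) + g (x k)
        + blinfun_apply (B k + dd (case k of 0 \<Rightarrow> xm | Suc j \<Rightarrow> x j) (x k)) (y k - x k)
        + v | v. v \<in> F (y k)} \<and>
      B (Suc k) = broyden_update (B k) (y k - x k) (f (y k) - f (x k)) \<and>
      (if y k \<in> C then x (Suc k) = y k
       else x (Suc k) = P k (y k) (x k) \<and> x (Suc k) \<in> inexact_proj C (y k) (x k) (\<theta> k) \<and>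
         condG_output C (\<theta> k) (y k) (x k) (x (Suc k)))"
    using run k unfolding broyden_secant_run_def by blast
  show "secant_residual f g (B k + dd (case k of 0 \<Rightarrow> xm | Suc j \<Rightarrow> x j) (x k)) (x k) (y k)
      \<in> sum_map f g F (y k)"
    using * unfolding linearized_inclusion_iff by blast
  show "0 \<notin> sum_map f g F (x k)" "B (Suc k) = broyden_update (B k) (y k - x k) (f (y k) - f (x k))"
    using * by blast+
  show "x (Suc k) = y k \<or> x (Suc k) \<in> inexact_proj C (y k) (x k) (\<theta> k)"
    and "x (Suc k) = (if y k \<in> C then y k else P k (y k) (x k))"
    using * by (cases "y k \<in> C"; simp)+
qed

text \<open>
  Strong regularity makes the inverse of \<open>f + g + F\<close> single-valued and Lipschitz on small values.
\<close>

locale strong_secant_broyden_setting = secant_broyden_setting +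
  assumes strong: "\<And>y y' u u'. y \<in> cball xs R \<Longrightarrow> y' \<in> cball xs R \<Longrightarrow> norm u \<le> \<beta> \<Longrightarrow> norm u' \<le> \<beta>
    \<Longrightarrow> u \<in> G y \<Longrightarrow> u' \<in> G y' \<Longrightarrow> norm (y - y') \<le> K * norm (u - u')"
begin

text \<open>
  Two solutions of the same subproblem have distance at most half their distance.
\<close>

lemma step_unique:
  assumes "t \<le> R" "t \<le> K * \<beta>" "K * (norm (B - A) + (L + c) * t) \<le> 1 / 2"
    and "v \<in> cball xs t" "x \<in> cball xs t" "y \<in> cball xs t" "y' \<in> cball xs t"
    and "secant_residual f g (B + dd v x) x y \<in> G y" "secant_residual f g (B + dd v x) x y' \<in> G y'"
  shows "y = y'"
proof -
  have "norm (y - y')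
      \<le> K * norm (secant_residual f g (B + dd v x) x y - secant_residual f g (B + dd v x) x y')"
    using assms by (intro strong residual_small) auto
  also have "\<dots> \<le> K * ((norm (B - A) + (L + c) * t) * norm (y - y'))"
    using assms pos by (intro mult_left_mono residual_lipschitz) auto
  also have "\<dots> \<le> 1 / 2 * norm (y - y')"
    using mult_right_mono[OF assms(3), of "norm (y - y')"] by (simp only: mult.assoc norm_ge_zero)
  finally show ?thesis
    by simp
qed

text \<open>
  Compare \<open>y\<close>, a preimage of the residual, with \<open>xs\<close>, a preimage of \<open>0\<close>.
\<close>

lemma step_estimate:
  assumes "t \<le> R" "t \<le> K * \<beta>" "K * (norm (B - A) + (L + c) * t) \<le> 1 / 2"
    and "v \<in> cball xs t" "x \<in> cball xs t" "y \<in> cball xs t"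
    and "secant_residual f g (B + dd v x) x y \<in> G y"
    and l: "0 \<le> l" "l \<le> 1 / 2"
      "K * (norm (blinfun_apply (B - A) (y - x)) + (L + c) * t * norm (y - x)) \<le> l * norm (y - x)"
  shows "norm (y - xs) \<le> 2 * l * norm (x - xs)"
proof -
  have "0 \<le> t"
    using assms(5) by (metis mem_cball order_trans zero_le_dist)
  have "norm (y - xs) \<le> K * norm (secant_residual f g (B + dd v x) x y - 0)"
    using assms pos \<open>0 \<le> t\<close> by (intro strong solution residual_small[of t]) auto
  also have "\<dots> \<le> K * (norm (blinfun_apply (B - A) (y - x)) + (L + c) * t * norm (y - x))"
    using residual_estimate[of t v x x y x B] assms pos
    by (intro mult_left_mono) (auto simp: secant_residual_def)
  also have "\<dots> \<le> l * norm (y - x)"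
    by (rule l)
  also have "\<dots> \<le> l * (norm (y - xs) + norm (x - xs))"
    using norm_triangle_ineq4[of "y - xs" "x - xs"] l(1) by (intro mult_left_mono) auto
  finally have "(1 - l) * norm (y - xs) \<le> l * norm (x - xs)"
    by (simp add: algebra_simps)
  moreover have "1 / 2 * norm (y - xs) \<le> (1 - l) * norm (y - xs)"
    using l by (intro mult_right_mono) auto
  ultimately show ?thesis
    by simp
qed

text \<open>
  The quantity \<open>\<sigma>\<close> measures how badly \<open>B k\<close> approximates \<open>A\<close> along the step that is actually taken. The
  threshold is chosen so that, together with the bound on \<open>(L + c) * \<tau>\<close>, a value below it makes the
  distance of \<open>y k\<close> to \<open>xs\<close> at most \<open>(1 - 2 * \<Theta>) / 8\<close> times that of \<open>x k\<close>; by \<open>inexact_step\<close> the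
  next iterate is then closer to \<open>xs\<close> by a fixed factor.
\<close>

lemma run_step:
  fixes B :: "nat \<Rightarrow> 'a \<Rightarrow>\<^sub>L 'a"
  assumes run: "broyden_secant_run \<Omega> C f g dd F \<theta> P xm x0 B0 N x y B"
    and within: "run_within xs \<tau> C N x y" and xm: "xm \<in> cball xs \<tau>" and k: "enat k < N"
    and \<tau>: "\<tau> \<le> R" "\<tau> \<le> K * \<beta>" and \<theta>: "0 \<le> \<theta> k" "\<theta> k \<le> \<Theta>" "\<Theta> < 1 / 2"
    and small: "K * ((L + c) * \<tau>) \<le> (1 - 2 * \<Theta>) / 32"
    and B: "K * (norm (B k - A) + (L + c) * \<tau>) \<le> 1 / 2"
  defines "\<sigma> \<equiv> norm (blinfun_apply (B k - A) (y k - x k)) / norm (y k - x k)"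
  shows "norm (B (Suc k) - A) \<le> norm (B k - A) + L * norm (x k - xs)"
    and "frobenius_sq (B (Suc k) - A) \<le> frobenius_sq (B k - A) - \<sigma>\<^sup>2 + (L * norm (x k - xs))\<^sup>2"
    and "norm (x (Suc k) - xs) \<le> 3 * norm (x k - xs)"
    and "\<sigma> \<le> (1 - 2 * \<Theta>) / (32 * K) \<Longrightarrow> norm (x (Suc k) - xs) \<le> sqrt (1 / 2 + \<Theta>) * norm (x k - xs)"
proof -
  define v where "v = (case k of 0 \<Rightarrow> xm | Suc j \<Rightarrow> x j)"
  define s where "s = y k - x k"
  define e where "e = norm (x k - xs)"
  have balls: "x k \<in> cball xs \<tau>" "y k \<in> cball xs \<tau>" "v \<in> cball xs \<tau>"
  proof -
    have x_in: "x j \<in> cball xs \<tau>" if "j \<le> k" for j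
    proof -
      have "enat j \<le> N"
        using that k by (meson enat_ord_simps(1) less_imp_le order_trans)
      then show ?thesis
        using within unfolding run_within_def by blast
    qed
    show "x k \<in> cball xs \<tau>"
      by (rule x_in) simp
    show "y k \<in> cball xs \<tau>"
      using within k unfolding run_within_def by blast
    show "v \<in> cball xs \<tau>"
      using xm x_in unfolding v_def by (cases k) auto
  qed
  have it: "0 \<notin> G (x k)" "secant_residual f g (B k + dd v (x k)) (x k) (y k) \<in> G (y k)"
      "B (Suc k) = broyden_update (B k) s (f (y k) - f (x k))"
      "x (Suc k) = y k \<or> x (Suc k) \<in> inexact_proj C (y k) (x k) (\<theta> k)"
    unfolding v_def s_def by (fact run_stepD[OF run k])+
  \<comment> \<open>The stopping test failed at \<open>x k\<close>, and the residual vanishes there.\<close>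
  have "s \<noteq> 0"
    using it(1,2) by (auto simp: s_def secant_residual_def)
  have near: "norm (y k - xs) \<le> 2 * l * e"
    if "0 \<le> l" "l \<le> 1 / 2" "K * (\<sigma> + (L + c) * \<tau>) \<le> l" for l
    unfolding e_def
  proof (rule step_estimate[OF \<tau> B balls(3,1,2) it(2) that(1,2)])
    show "K * (norm (blinfun_apply (B k - A) (y k - x k)) + (L + c) * \<tau> * norm (y k - x k))
        \<le> l * norm (y k - x k)"
      using mult_right_mono[OF that(3), of "norm s"] \<open>s \<noteq> 0\<close>
      by (simp add: \<sigma>_def s_def algebra_simps)
  qed
  have "\<sigma> \<le> norm (B k - A)"
    using norm_blinfun[of "B k - A" s] \<open>s \<noteq> 0\<close> by (simp add: \<sigma>_def s_def divide_le_eq)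
  then have "K * (\<sigma> + (L + c) * \<tau>) \<le> K * (norm (B k - A) + (L + c) * \<tau>)"
    using pos by (intro mult_left_mono) auto
  then have y_near: "norm (y k - xs) \<le> e"
    using near[of "1 / 2"] B by simp
  have e_in: "e \<le> R" "x k \<in> cball xs e" "y k \<in> cball xs e"
    using balls \<tau> y_near by (auto simp: e_def dist_norm norm_minus_commute)
  show "norm (B (Suc k) - A) \<le> norm (B k - A) + L * norm (x k - xs)"
    unfolding it s_def e_def[symmetric] by (rule broyden_deterioration(2)[OF e_in])
  show "frobenius_sq (B (Suc k) - A) \<le> frobenius_sq (B k - A) - \<sigma>\<^sup>2 + (L * norm (x k - xs))\<^sup>2"
  proof -
    have "(norm (f (y k) - f (x k) - blinfun_apply A s) / norm s)\<^sup>2 \<le> (L * e)\<^sup>2"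
      unfolding s_def using broyden_deterioration(1)[OF e_in] by (intro power_mono) auto
    then show ?thesis
      using frobenius_sq_broyden_update[OF \<open>s \<noteq> 0\<close>, of "B k" "f (y k) - f (x k)" A]
      by (simp add: it(3) \<sigma>_def s_def e_def)
  qed
  show "norm (x (Suc k) - xs) \<le> 3 * norm (x k - xs)"
    using inexact_step(1)[OF it(4) C(3) \<theta>] y_near by (simp add: e_def)
  show "norm (x (Suc k) - xs) \<le> sqrt (1 / 2 + \<Theta>) * norm (x k - xs)" if "\<sigma> \<le> (1 - 2 * \<Theta>) / (32 * K)"
  proof (rule inexact_step(2)[OF it(4) C(3) \<theta>])
    have "K * \<sigma> \<le> (1 - 2 * \<Theta>) / 32"
      using that pos by (simp add: field_simps)
    then have "K * (\<sigma> + (L + c) * \<tau>) \<le> (1 - 2 * \<Theta>) / 16"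
      using small by (simp add: distrib_left)
    then show "norm (y k - xs) \<le> (1 - 2 * \<Theta>) / 8 * norm (x k - xs)"
      using near[of "(1 - 2 * \<Theta>) / 16"] \<theta> by (simp add: e_def field_simps)
  qed
qed

text \<open>
  The hypotheses on \<open>\<rho>\<close>, \<open>\<rho>'\<close>, \<open>a\<close>, \<open>D\<close> are those of \<open>lyapunov_decay\<close>; they can be met for small \<open>\<tau>\<close>.
  The Lyapunov function alone gives a geometric bound on the errors but no contraction from one
  error to the next. For that, the telescoping of the Frobenius norms shows that \<open>\<sigma> k\<close> tends to
  \<open>0\<close>, so that only good steps remain.
\<close>

lemma run_decay:
  fixes B :: "nat \<Rightarrow> 'a \<Rightarrow>\<^sub>L 'a"
  assumes run: "broyden_secant_run \<Omega> C f g dd F \<theta> P xm x0 B0 N x y B"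
    and within: "run_within xs \<tau> C N x y" and xm: "xm \<in> cball xs \<tau>"
    and \<tau>: "0 \<le> \<tau>" "\<tau> \<le> R" "\<tau> \<le> K * \<beta>" and \<theta>: "\<And>k. 0 \<le> \<theta> k" "\<And>k. \<theta> k \<le> \<Theta>" "\<Theta> < 1 / 2"
    and small: "K * ((L + c) * \<tau>) \<le> (1 - 2 * \<Theta>) / 32"
    and D: "K * (D + (L + c) * \<tau>) \<le> 1 / 2"
    and \<rho>: "\<rho> = sqrt (1 / 2 + \<Theta>)" "a = ln (3 / \<rho>) / ((1 - 2 * \<Theta>) / (32 * K))\<^sup>2"
      "\<rho> * exp (a * (L * \<tau>)\<^sup>2) \<le> \<rho>'" "\<rho>' < 1"
    and start: "norm (B0 - A) + L * \<tau> * exp (a * frobenius_sq (B0 - A)) / (1 - \<rho>') \<le> D"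
  shows "enat k \<le> N \<Longrightarrow> norm (B k - A) \<le> D"
    and "N = \<infinity> \<Longrightarrow> q_linearly_convergent x xs"
proof -
  define \<sigma> where "\<sigma> k = norm (blinfun_apply (B k - A) (y k - x k)) / norm (y k - x k)" for k
  define \<epsilon> where "\<epsilon> = (1 - 2 * \<Theta>) / (32 * K)"
  have "0 < \<epsilon>"
    using \<theta> pos by (simp add: \<epsilon>_def)
  have "0 \<le> \<Theta>"
    using \<theta>(1,2) order_trans by blast
  then have \<rho>01: "0 < \<rho>" "\<rho> < 1"
    using \<theta>(3) by (auto simp: \<rho>)
  have "B 0 = B0"
    using run by (simp add: broyden_secant_run_def)
  have bound: "K * (norm (B k - A) + (L + c) * \<tau>) \<le> 1 / 2" if "norm (B k - A) \<le> D" for k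
  proof -
    have "K * (norm (B k - A) + (L + c) * \<tau>) \<le> K * (D + (L + c) * \<tau>)"
      using that pos by (intro mult_left_mono) auto
    then show ?thesis
      using D by linarith
  qed
  note step = run_step[OF run within xm _ \<tau>(2,3) \<theta>(1,2,3) small bound, folded \<sigma>_def]
  have decay: "norm (x k - xs) \<le> \<rho>' ^ k * (\<tau> * exp (a * frobenius_sq (B0 - A)))" "norm (B k - A) \<le> D"
    if "enat k \<le> N" for k
  proof -
    have before: "enat j < N" if "j < k" for j
      using that \<open>enat k \<le> N\<close> by (metis enat_ord_simps(2) order_less_le_trans)
    have ball: "norm (x j - xs) \<le> \<tau>" if "j \<le> k" for j
    proof -
      have "enat j \<le> N"
        using that \<open>enat k \<le> N\<close> by (metis enat_ord_simps(1) order_trans)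
      then show ?thesis
        using within by (auto simp: run_within_def dist_norm norm_minus_commute)
    qed
    have start': "norm (B 0 - A) + L * \<tau> * exp (a * frobenius_sq (B 0 - A)) / (1 - \<rho>') \<le> D"
      unfolding \<open>B 0 = B0\<close> by (rule start)
    have "0 \<le> \<sigma> j" for j
      by (simp add: \<sigma>_def)
    note * = lyapunov_decay[where e = "\<lambda>j. norm (x j - xs)" and \<sigma> = \<sigma> and d = "\<lambda>j. norm (B j - A)"
        and \<phi> = "\<lambda>j. frobenius_sq (B j - A)" and n = k and k = k and \<rho> = \<rho> and \<epsilon> = \<epsilon> and L = L
        and \<tau> = \<tau> and \<rho>' = \<rho>' and D = D and c = a, OF norm_ge_zero frobenius_sq_nonneg this
        \<rho>01 \<open>0 < \<epsilon>\<close> pos(4) \<tau>(1) \<rho>(4) ball step(1)[OF before] step(2)[OF before] step(3)[OF before]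
        step(4)[OF before, folded \<epsilon>_def \<rho>(1)] \<rho>(2)[folded \<epsilon>_def] \<rho>(3) start' order_refl]
    show "norm (x k - xs) \<le> \<rho>' ^ k * (\<tau> * exp (a * frobenius_sq (B0 - A)))"
      using *(1) unfolding \<open>B 0 = B0\<close> .
    show "norm (B k - A) \<le> D"
      by (rule *(2))
  qed
  then show "enat k \<le> N \<Longrightarrow> norm (B k - A) \<le> D"
    by blast
  show "q_linearly_convergent x xs" if "N = \<infinity>"
  proof -
    define V where "V = \<tau> * exp (a * frobenius_sq (B0 - A))"
    have e_le: "norm (x k - xs) \<le> \<rho>' ^ k * V" for k
      using decay(1)[of k] that by (simp add: V_def)
    have "0 < \<rho>'"
      using \<rho>(3) \<rho>01 by (smt (verit) exp_gt_zero mult_pos_pos)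
    have step': "frobenius_sq (B (Suc k) - A) \<le> frobenius_sq (B k - A) - (\<sigma> k)\<^sup>2 + (L * norm (x k - xs))\<^sup>2"
        "\<sigma> k \<le> \<epsilon> \<Longrightarrow> norm (x (Suc k) - xs) \<le> \<rho> * norm (x k - xs)" for k
      using step(2,4)[of k] decay(2)[of k] that by (auto simp: \<epsilon>_def \<rho>(1))
    have "(\<lambda>k. (\<sigma> k)\<^sup>2) \<longlonglongrightarrow> 0"
    proof (rule tendsto_zero_of_telescoping[where r = "\<lambda>k. (L * norm (x k - xs))\<^sup>2"])
      show "summable (\<lambda>k. (L * norm (x k - xs))\<^sup>2)"
      proof (rule summable_comparison_test'[where N = 0])
        have "\<rho>'\<^sup>2 < 1"
          using \<open>0 < \<rho>'\<close> \<rho>(4) by (simp add: power_less_one_iff)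
        then show "summable (\<lambda>k. (L * V)\<^sup>2 * (\<rho>'\<^sup>2) ^ k)"
          by (intro summable_mult[OF summable_geometric]) simp
        show "norm ((L * norm (x k - xs))\<^sup>2) \<le> (L * V)\<^sup>2 * (\<rho>'\<^sup>2) ^ k" for k
        proof -
          have "(L * norm (x k - xs))\<^sup>2 \<le> (L * (\<rho>' ^ k * V))\<^sup>2"
            using e_le[of k] pos by (intro power_mono mult_left_mono) auto
          moreover have "(\<rho>' ^ k)\<^sup>2 = (\<rho>'\<^sup>2) ^ k"
            by (simp only: power_mult[symmetric] mult.commute)
          ultimately show ?thesis
            by (simp add: power_mult_distrib mult.commute mult.left_commute)
        qed
      qed
      show "frobenius_sq (B (Suc k) - A) \<le> frobenius_sq (B k - A) - (\<sigma> k)\<^sup>2 + (L * norm (x k - xs))\<^sup>2" for k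
        by (rule step')
    qed (auto simp: frobenius_sq_nonneg)
    then have "\<forall>\<^sub>F k in sequentially. (\<sigma> k)\<^sup>2 < \<epsilon>\<^sup>2"
      using \<open>0 < \<epsilon>\<close> order_tendstoD(2)[of "\<lambda>k. (\<sigma> k)\<^sup>2" 0] by auto
    then have "\<forall>\<^sub>F k in sequentially. norm (x (Suc k) - xs) \<le> \<rho> * norm (x k - xs)"
    proof eventually_elim
      case (elim k)
      then have "\<sigma> k < \<epsilon>"
        using \<open>0 < \<epsilon>\<close> power_less_imp_less_base[of "\<sigma> k" 2 \<epsilon>] by simp
      then show ?case
        using step'(2) by simp
    qed
    moreover have "(\<lambda>k. \<rho>' ^ k * V) \<longlonglongrightarrow> 0"
      using \<open>0 < \<rho>'\<close> \<rho>(4) by (intro tendsto_mult_left_zero LIMSEQ_realpow_zero) auto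
    then have "(\<lambda>k. x k - xs) \<longlonglongrightarrow> 0"
      by (rule Lim_null_comparison[rotated]) (use e_le in auto)
    then have "x \<longlonglongrightarrow> xs"
      by (rule LIM_zero_cancel)
    ultimately show ?thesis
      unfolding q_linearly_convergent_def using \<rho>01 by blast
  qed
qed

text \<open>
  By induction both runs have the same iterates and operators: the subproblem determines \<open>y k\<close>, and
  \<open>P\<close> determines the inexact projection. Hence the stopping test succeeds at the same index.
\<close>

lemma run_unique:
  fixes B B' :: "nat \<Rightarrow> 'a \<Rightarrow>\<^sub>L 'a"
  assumes run: "broyden_secant_run \<Omega> C f g dd F \<theta> P xm x0 B0 N x y B" "run_within xs \<tau> C N x y"
    and run': "broyden_secant_run \<Omega> C f g dd F \<theta> P xm x0 B0 N' x' y' B'" "run_within xs \<tau> C N' x' y'"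
    and xm: "xm \<in> cball xs \<tau>" and \<tau>: "\<tau> \<le> R" "\<tau> \<le> K * \<beta>"
    and B: "\<And>k. enat k \<le> N \<Longrightarrow> K * (norm (B k - A) + (L + c) * \<tau>) \<le> 1 / 2"
  shows "N' = N \<and> (\<forall>k. enat k \<le> N \<longrightarrow> x' k = x k)"
proof -
  have same: "x' k = x k \<and> B' k = B k" if "enat k \<le> N" "enat k \<le> N'" for k
    using that
  proof (induction k rule: less_induct)
    case (less k)
    show ?case
    proof (cases k)
      case 0
      then show ?thesis
        using run(1) run'(1) by (simp add: broyden_secant_run_def)
    next
      case (Suc j)
      have j: "enat j < N" "enat j < N'"
        using less.prems Suc by (metis Suc_ile_eq)+
      have IH: "x' i = x i" "B' i = B i" if "i \<le> j" for i
      proof -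
        have "enat i \<le> N" "enat i \<le> N'"
          using j that by (meson enat_ord_simps(1) less_imp_le order_trans)+
        then show "x' i = x i" "B' i = B i"
          using less.IH[of i] that Suc by auto
      qed
      define v where "v = (case j of 0 \<Rightarrow> xm | Suc i \<Rightarrow> x i)"
      have v': "(case j of 0 \<Rightarrow> xm | Suc i \<Rightarrow> x' i) = v"
        using IH by (simp add: v_def split: nat.split)
      have "enat i \<le> N" if "i \<le> j" for i
        using j that by (meson enat_ord_simps(1) less_imp_le order_trans)
      then have x_in: "x i \<in> cball xs \<tau>" if "i \<le> j" for i
        using run(2) that unfolding run_within_def by blast
      have "v \<in> cball xs \<tau>"
        using xm x_in unfolding v_def by (cases j) auto
      moreover have "y j \<in> cball xs \<tau>" "y' j \<in> cball xs \<tau>"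
        using run(2) run'(2) j unfolding run_within_def by blast+
      moreover have "secant_residual f g (B j + dd v (x j)) (x j) (y j) \<in> G (y j)"
        using run_stepD(2)[OF run(1) j(1)] unfolding v_def .
      moreover have "secant_residual f g (B j + dd v (x j)) (x j) (y' j) \<in> G (y' j)"
        using run_stepD(2)[OF run'(1) j(2)] unfolding v' IH[OF order_refl] .
      ultimately have "y' j = y j"
        using step_unique[OF \<tau> B[of j]] j(1) x_in[of j] by (metis less_imp_le order_refl)
      then show ?thesis
        using run_stepD(3,5)[OF run(1) j(1)] run_stepD(3,5)[OF run'(1) j(2)] IH[of j] Suc by simp
    qed
  qed
  have stop: "0 \<in> G (x m)" if "N = enat m" for m
    using run(1) that by (simp add: broyden_secant_run_def)
  have stop': "0 \<in> G (x' m)" if "N' = enat m" for m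
    using run'(1) that by (simp add: broyden_secant_run_def)
  have "\<not> N < N'"
  proof
    assume "N < N'"
    then obtain m where m: "N = enat m"
      by (cases N) auto
    then show False
      using run_stepD(1)[OF run'(1), of m] stop[OF m] same[of m] \<open>N < N'\<close> by auto
  qed
  moreover have "\<not> N' < N"
  proof
    assume "N' < N"
    then obtain m where m: "N' = enat m"
      by (cases N') auto
    then show False
      using run_stepD(1)[OF run(1), of m] stop'[OF m] same[of m] \<open>N' < N\<close> by auto
  qed
  ultimately have "N' = N"
    by (simp add: not_less)
  then show ?thesis
    using same by auto
qed

lemma run_unique_eventually:
  assumes B0: "K * norm (B0 - A) < 1 / 2"
    and \<theta>: "\<And>k. 0 \<le> \<theta> k" "\<And>k. \<theta> k \<le> \<Theta>" "\<Theta> < 1 / 2"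
  shows "\<forall>\<^sub>F \<tau> in at_right 0. \<forall>xm \<in> cball xs \<tau> \<inter> C. \<forall>x0 \<in> cball xs \<tau> \<inter> C. \<forall>P N x y B.
    broyden_secant_run \<Omega> C f g dd F \<theta> P xm x0 B0 N x y B \<and> run_within xs \<tau> C N x y \<longrightarrow>
    (N = \<infinity> \<longrightarrow> q_linearly_convergent x xs) \<and>
    (\<forall>N' x' y' B'. broyden_secant_run \<Omega> C f g dd F \<theta> P xm x0 B0 N' x' y' B' \<and>
            run_within xs \<tau> C N' x' y' \<longrightarrow>
      N' = N \<and> (\<forall>k. enat k \<le> N \<longrightarrow> x' k = x k))"
proof -
  define \<rho> where "\<rho> = sqrt (1 / 2 + \<Theta>)"
  define a where "a = ln (3 / \<rho>) / ((1 - 2 * \<Theta>) / (32 * K))\<^sup>2"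
  have "\<rho> < 1"
    using \<theta>(3) by (simp add: \<rho>_def)
  then obtain \<rho>' where \<rho>': "\<rho> < \<rho>'" "\<rho>' < 1"
    using dense by blast
  have "norm (B0 - A) < 1 / (2 * K)"
    using B0 pos by (simp add: field_simps)
  then obtain D where D: "norm (B0 - A) < D" "D < 1 / (2 * K)"
    using dense by blast
  have "\<forall>\<^sub>F \<tau> in at_right 0. 0 < \<tau> \<and> \<tau> < min R (K * \<beta>)"
    using pos by (intro eventually_at_rightI[of 0 "min R (K * \<beta>)"]) auto
  moreover have "\<forall>\<^sub>F \<tau> in at_right 0. K * ((L + c) * \<tau>) < (1 - 2 * \<Theta>) / 32"
  proof (rule order_tendstoD(2))
    show "((\<lambda>\<tau>. K * ((L + c) * \<tau>)) \<longlongrightarrow> K * ((L + c) * 0)) (at_right 0)"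
      by (intro tendsto_intros)
  qed (use \<theta>(3) in simp)
  moreover have "\<forall>\<^sub>F \<tau> in at_right 0. K * (D + (L + c) * \<tau>) < 1 / 2"
  proof (rule order_tendstoD(2))
    show "((\<lambda>\<tau>. K * (D + (L + c) * \<tau>)) \<longlongrightarrow> K * (D + (L + c) * 0)) (at_right 0)"
      by (intro tendsto_intros)
  qed (use D pos in \<open>simp add: field_simps\<close>)
  moreover have "\<forall>\<^sub>F \<tau> in at_right 0. \<rho> * exp (a * (L * \<tau>)\<^sup>2) < \<rho>'"
  proof (rule order_tendstoD(2))
    show "((\<lambda>\<tau>. \<rho> * exp (a * (L * \<tau>)\<^sup>2)) \<longlongrightarrow> \<rho> * exp (a * (L * 0)\<^sup>2)) (at_right 0)"
      by (intro tendsto_intros)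
  qed (use \<rho>' in simp)
  moreover have "\<forall>\<^sub>F \<tau> in at_right 0.
      norm (B0 - A) + L * \<tau> * exp (a * frobenius_sq (B0 - A)) / (1 - \<rho>') < D"
  proof (rule order_tendstoD(2))
    show "((\<lambda>\<tau>. norm (B0 - A) + L * \<tau> * exp (a * frobenius_sq (B0 - A)) / (1 - \<rho>')) \<longlongrightarrow>
        norm (B0 - A) + L * 0 * exp (a * frobenius_sq (B0 - A)) / (1 - \<rho>')) (at_right 0)"
      using \<rho>' by (intro tendsto_intros) auto
  qed (use D in simp)
  ultimately show ?thesis
  proof eventually_elim
    case (elim \<tau>)
    then have \<tau>: "0 \<le> \<tau>" "\<tau> \<le> R" "\<tau> \<le> K * \<beta>"
      by auto
    show ?case
    proof (intro ballI allI impI; elim conjE)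
      fix xm x0 P N x y B
      assume xm: "xm \<in> cball xs \<tau> \<inter> C"
        and run: "broyden_secant_run \<Omega> C f g dd F \<theta> P xm x0 B0 N x y B" "run_within xs \<tau> C N x y"
      then have "xm \<in> cball xs \<tau>"
        by blast
      note decay = run_decay[OF run this \<tau> \<theta> less_imp_le[OF elim(2)] less_imp_le[OF elim(3)]
          \<rho>_def a_def less_imp_le[OF elim(4)] \<rho>'(2) less_imp_le[OF elim(5)]]
      have bound: "K * (norm (B k - A) + (L + c) * \<tau>) \<le> 1 / 2" if "enat k \<le> N" for k
      proof -
        have "K * (norm (B k - A) + (L + c) * \<tau>) \<le> K * (D + (L + c) * \<tau>)"
          using decay(1)[OF that] pos by (intro mult_left_mono) auto
        then show ?thesis
          using elim(3) by linarith
      qed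
      show "(N = \<infinity> \<longrightarrow> q_linearly_convergent x xs) \<and>
          (\<forall>N' x' y' B'. broyden_secant_run \<Omega> C f g dd F \<theta> P xm x0 B0 N' x' y' B' \<and>
            run_within xs \<tau> C N' x' y' \<longrightarrow>
            N' = N \<and> (\<forall>k. enat k \<le> N \<longrightarrow> x' k = x k))"
        using decay(2) run_unique[OF run _ _ \<open>xm \<in> cball xs \<tau>\<close> \<tau>(2,3) bound] by blast
    qed
  qed
qed

end

section \<open>The local convergence theorem\<close>

lemma lipschitz_derivative_linearization:
  fixes f :: "'a::real_normed_vector \<Rightarrow> 'b::real_normed_vector"
  assumes "cball z t \<subseteq> D" and f': "\<And>x. x \<in> D \<Longrightarrow> (f has_derivative blinfun_apply (f' x)) (at x)"
    and lip: "\<And>x y. x \<in> D \<Longrightarrow> y \<in> D \<Longrightarrow> norm (f' x - f' y) \<le> L * norm (x - y)"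
    and "0 \<le> L" and x: "x \<in> cball z t" and y: "y \<in> cball z t"
  shows "norm (f y - f x - blinfun_apply (f' z) (y - x)) \<le> L * t * norm (y - x)"
proof -
  have "z \<in> cball z t"
    using x by (metis centre_in_cball mem_cball order_trans zero_le_dist)
  have "norm (f y - f x - blinfun_apply (f' z) (y - x)) \<le> norm (y - x) * (L * t)"
  proof (rule differentiable_bound_linearization[where S = "cball z t" and f' = "\<lambda>x. blinfun_apply (f' x)"])
    show "x + s *\<^sub>R (y - x) \<in> cball z t" if "s \<in> {0..1}" for s
    proof -
      have "x + s *\<^sub>R (y - x) \<in> closed_segment x y"
        using that by (auto simp: closed_segment_def algebra_simps intro!: exI[of _ s])
      then show ?thesis
        using x y closed_segment_subset[OF _ _ convex_cball] by blast
    qed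
    show "(f has_derivative blinfun_apply (f' p)) (at p within cball z t)" if "p \<in> cball z t" for p
      using f' that \<open>cball z t \<subseteq> D\<close> by (blast intro: has_derivative_at_withinI)
    show "onorm (blinfun_apply (f' p) - blinfun_apply (f' z)) \<le> L * t" if "p \<in> cball z t" for p
    proof -
      have "norm (f' p - f' z) \<le> L * norm (p - z)"
        using lip that \<open>z \<in> cball z t\<close> \<open>cball z t \<subseteq> D\<close> by blast
      also have "\<dots> \<le> L * t"
        using that \<open>0 \<le> L\<close> by (intro mult_left_mono) (auto simp: dist_norm norm_minus_commute)
      finally show ?thesis
        by (simp add: norm_blinfun.rep_eq minus_blinfun.rep_eq fun_diff_def)
    qed
  qed (fact \<open>z \<in> cball z t\<close>)
  then show ?thesis
    by (simp add: mult.commute)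
qed

theorem theorem6:
  fixes \<Omega> C :: "(real ^ 'n) set"
    and f g :: "(real ^ 'n) \<Rightarrow> (real ^ 'n)"
    and f' :: "(real ^ 'n) \<Rightarrow> ((real ^ 'n) \<Rightarrow>\<^sub>L (real ^ 'n))"
    and F :: "(real ^ 'n) \<Rightarrow> (real ^ 'n) set"
    and dd :: "(real ^ 'n) \<Rightarrow> (real ^ 'n) \<Rightarrow> ((real ^ 'n) \<Rightarrow>\<^sub>L (real ^ 'n))"
    and dd2 :: "(real ^ 'n) \<Rightarrow> (real ^ 'n) \<Rightarrow> (real ^ 'n) \<Rightarrow>
                  ((real ^ 'n) \<Rightarrow>\<^sub>L ((real ^ 'n) \<Rightarrow>\<^sub>L (real ^ 'n)))"
    and xs :: "(real ^ 'n)"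
    and B0 :: "(real ^ 'n) \<Rightarrow>\<^sub>L (real ^ 'n)"
    and \<theta> :: "nat \<Rightarrow> real"
    and L M \<kappa> a b :: real
  assumes "open \<Omega>"
    and "C \<subseteq> \<Omega>" and "closed C" and "convex C"
    and f_C1: "\<And>x. x \<in> \<Omega> \<Longrightarrow> (f has_derivative blinfun_apply (f' x)) (at x)"
              "continuous_on \<Omega> f'"
    and "continuous_on \<Omega> g"
    and "divided_difference \<Omega> g dd" and "divided_difference2 \<Omega> g dd dd2"
    and "closed (sv_graph UNIV F)"
    and "xs \<in> \<Omega>" and "0 \<in> sum_map f g F xs"
    and i: "L > 0" "\<And>x y. x \<in> \<Omega> \<Longrightarrow> y \<in> \<Omega> \<Longrightarrow> norm (f' x - f' y) \<le> L * norm (x - y)"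
    and ii: "M > 0" "\<And>x y z. x \<in> \<Omega> \<Longrightarrow> y \<in> \<Omega> \<Longrightarrow> z \<in> \<Omega> \<Longrightarrow> norm (dd2 x y z) \<le> M"
    and iii: "metrically_regular \<Omega> (sum_map f g F) xs 0 \<kappa> a b"
    and "norm (B0 - f' xs) < 1 / (2 * \<kappa>)"
    and "\<And>k. \<theta> k \<ge> 0" and "bdd_above (range \<theta>)" and "(SUP k. \<theta> k) < 1 / 2"
  shows "\<exists>\<tau>>0.
    (\<forall>xm \<in> cball xs \<tau> \<inter> C. \<forall>x0 \<in> cball xs \<tau> \<inter> C.
       \<exists>P N x y B.
         broyden_secant_run \<Omega> C f g dd F \<theta> P xm x0 B0 N x y B \<and>
         run_within xs \<tau> C N x y \<and>
         (N = \<infinity> \<longrightarrow>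
            (\<forall>k. x k \<noteq> xs \<and> x (Suc k) \<noteq> x k) \<and> q_linearly_convergent x xs)) \<and>
    ((\<exists>\<kappa>' a' b'. strongly_metrically_regular \<Omega> (sum_map f g F) xs 0 \<kappa>' a' b') \<longrightarrow>
       (\<forall>xm \<in> cball xs \<tau> \<inter> C. \<forall>x0 \<in> cball xs \<tau> \<inter> C.
          \<forall>P N x y B.
            broyden_secant_run \<Omega> C f g dd F \<theta> P xm x0 B0 N x y B \<and>
            run_within xs \<tau> C N x y \<longrightarrow>
            (N = \<infinity> \<longrightarrow> q_linearly_convergent x xs) \<and>
            (\<forall>N' x' y' B'.
               broyden_secant_run \<Omega> C f g dd F \<theta> P xm x0 B0 N' x' y' B' \<and>
               run_within xs \<tau> C N' x' y' \<longrightarrow>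
               N' = N \<and> (\<forall>k. enat k \<le> N \<longrightarrow> x' k = x k))))"
proof -
  have \<Theta>: "\<theta> k \<le> (SUP k. \<theta> k)" for k
    using \<open>bdd_above (range \<theta>)\<close> by (intro cSUP_upper) auto
  have mr: "0 < \<kappa>" "0 < a" "0 < b" "cball xs a \<subseteq> \<Omega>"
    using iii by (auto simp: metrically_regular_def)
  let ?\<delta> = "norm (B0 - f' xs)"
  obtain K where K: "\<kappa> < K" "K * ?\<delta> < 1 / 2"
  proof (cases "?\<delta> = 0")
    case True
    then show ?thesis
      using that[of "\<kappa> + 1"] by simp
  next
    case False
    then have "0 < ?\<delta>"
      using norm_ge_zero[of "B0 - f' xs"] by linarith
    then have "\<kappa> < 1 / (2 * ?\<delta>)"
      using \<open>?\<delta> < 1 / (2 * \<kappa>)\<close> mr by (simp add: field_simps)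
    then obtain K where "\<kappa> < K" "K < 1 / (2 * ?\<delta>)"
      using dense by blast
    then show ?thesis
      using that[of K] \<open>0 < ?\<delta>\<close> by (simp add: field_simps)
  qed
  have setting: "secant_broyden_setting \<Omega> C f g dd F xs (f' xs) R \<beta> K L (16 * M)"
    if "xs \<in> C" and R: "0 < R" "R \<le> a" and \<beta>: "0 < \<beta>" "\<beta> \<le> b" for R \<beta>
  proof
    show "cball xs R \<subseteq> \<Omega>"
      using mr R by auto
    then have sub: "cball xs t \<subseteq> \<Omega>" if "t \<le> R" for t
      using that by auto
    show "continuous_on (cball xs R) f"
      using f_C1(1) \<open>cball xs R \<subseteq> \<Omega>\<close>
      by (intro has_derivative_continuous_on[where f' = "\<lambda>x. blinfun_apply (f' x)"])
         (blast intro: has_derivative_at_withinI)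
    show "continuous_on (cball xs R) g"
      using \<open>continuous_on \<Omega> g\<close> \<open>cball xs R \<subseteq> \<Omega>\<close> continuous_on_subset by blast
    show "\<exists>p. u \<in> sum_map f g F p \<and> norm (x - p) \<le> K * norm (u - v)"
      if "x \<in> cball xs R" "norm u \<le> \<beta>" "v \<in> sum_map f g F x" for x u v
      using metrically_regular_preimage[OF iii K(1), of x u v] that R \<beta> by auto
    show "norm (f y - f x - blinfun_apply (f' xs) (y - x)) \<le> L * t * norm (y - x)"
      if "t \<le> R" "x \<in> cball xs t" "y \<in> cball xs t" for t x y
      using lipschitz_derivative_linearization[OF sub[OF that(1)] f_C1(1) i(2)] i(1) that by auto
    show "norm (g y - g x - blinfun_apply (dd v w) (y - x)) \<le> 16 * M * t * norm (y - x)"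
      if "t \<le> R" "v \<in> cball xs t" "w \<in> cball xs t" "x \<in> cball xs t" "y \<in> cball xs t" for t v w x y
      using divided_difference_secant[OF \<open>open \<Omega>\<close> sub[OF that(1)] \<open>divided_difference \<Omega> g dd\<close>
          \<open>divided_difference2 \<Omega> g dd dd2\<close> ii(2)] that by blast
  qed (use that K mr assms in auto)
  let ?E = "\<lambda>\<tau>. \<forall>xm \<in> cball xs \<tau> \<inter> C. \<forall>x0 \<in> cball xs \<tau> \<inter> C. \<exists>P N x y B.
    broyden_secant_run \<Omega> C f g dd F \<theta> P xm x0 B0 N x y B \<and> run_within xs \<tau> C N x y \<and>
    (N = \<infinity> \<longrightarrow> (\<forall>k. x k \<noteq> xs \<and> x (Suc k) \<noteq> x k) \<and> q_linearly_convergent x xs)"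
  let ?S = "\<exists>\<kappa>' a' b'. strongly_metrically_regular \<Omega> (sum_map f g F) xs 0 \<kappa>' a' b'"
  let ?U = "\<lambda>\<tau>. \<forall>xm \<in> cball xs \<tau> \<inter> C. \<forall>x0 \<in> cball xs \<tau> \<inter> C. \<forall>P N x y B.
    broyden_secant_run \<Omega> C f g dd F \<theta> P xm x0 B0 N x y B \<and> run_within xs \<tau> C N x y \<longrightarrow>
    (N = \<infinity> \<longrightarrow> q_linearly_convergent x xs) \<and>
    (\<forall>N' x' y' B'. broyden_secant_run \<Omega> C f g dd F \<theta> P xm x0 B0 N' x' y' B' \<and>
       run_within xs \<tau> C N' x' y' \<longrightarrow> N' = N \<and> (\<forall>k. enat k \<le> N \<longrightarrow> x' k = x k))"
  have "\<forall>\<^sub>F \<tau> in at_right 0. ?E \<tau> \<and> (?S \<longrightarrow> ?U \<tau>)"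
  proof (cases "xs \<in> C")
    case False
    then obtain r where r: "0 < r" "cball xs r \<subseteq> - C"
      using \<open>closed C\<close> open_contains_cball[of "- C"] by (auto simp: open_Compl)
    have "\<forall>\<^sub>F \<tau> in at_right 0. \<tau> < r"
      using r by (intro eventually_at_rightI[of 0 r]) auto
    then show ?thesis
    proof eventually_elim
      case (elim \<tau>)
      then have "cball xs \<tau> \<subseteq> cball xs r"
        by auto
      then have "cball xs \<tau> \<inter> C = {}"
        using r by blast
      then show ?case
        by simp
    qed
  next
    case True
    have "eventually ?E (at_right 0)"
      using secant_broyden_setting.run_exists_eventually[
          OF setting[OF True mr(2) order_refl mr(3) order_refl] K(2)]
        \<open>\<And>k. \<theta> k \<ge> 0\<close> by blast
    moreover have "eventually ?U (at_right 0)" if strong: ?S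
    proof -
      obtain \<kappa>' a' b' where smr: "strongly_metrically_regular \<Omega> (sum_map f g F) xs 0 \<kappa>' a' b'"
        using strong by blast
      then have pos': "0 < a'" "0 < b'"
        by (auto simp: strongly_metrically_regular_def metrically_regular_def)
      \<comment> \<open>Chosen so that \<open>R + 2 * K * \<beta> \<le> a'\<close>.\<close>
      define R where "R = min a (a' / 2)"
      define \<beta> where "\<beta> = min (min b b') (a' / (4 * K))"
      have R: "0 < R" "R \<le> a" and \<beta>: "0 < \<beta>" "\<beta> \<le> b" "\<beta> \<le> b'"
        using mr pos' K by (auto simp: R_def \<beta>_def)
      have "\<beta> \<le> a' / (4 * K)"
        by (simp add: \<beta>_def)
      then have "2 * K * \<beta> \<le> a' / 2"
        using mr K by (simp add: field_simps)
      then have fit: "R + 2 * K * \<beta> \<le> a'"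
        unfolding R_def by linarith
      have "strong_secant_broyden_setting \<Omega> C f g dd F xs (f' xs) R \<beta> K L (16 * M)"
      proof (intro strong_secant_broyden_setting.intro strong_secant_broyden_setting_axioms.intro)
        show "secant_broyden_setting \<Omega> C f g dd F xs (f' xs) R \<beta> K L (16 * M)"
          by (rule setting[OF True R \<beta>(1,2)])
        show "norm (y - y') \<le> K * norm (u - u')"
          if "y \<in> cball xs R" "y' \<in> cball xs R" "norm u \<le> \<beta>" "norm u' \<le> \<beta>"
            "u \<in> sum_map f g F y" "u' \<in> sum_map f g F y'" for y y' u u'
          using strongly_metrically_regular_lipschitz[OF iii K(1) smr R(2) \<beta>(2,3) fit] that by simp
      qed
      then interpret strong_secant_broyden_setting \<Omega> C f g dd F xs "f' xs" R \<beta> K L "16 * M" .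
      show ?thesis
        by (rule run_unique_eventually[OF K(2) _ \<Theta>]) (use assms in auto)
    qed
    then have "\<forall>\<^sub>F \<tau> in at_right 0. ?S \<longrightarrow> ?U \<tau>"
      by (cases ?S) (blast intro: eventually_mono, simp only: simp_thms eventually_True)
    ultimately show ?thesis
      by eventually_elim (rule conjI)
  qed
  then have "\<forall>\<^sub>F \<tau> in at_right 0. 0 < \<tau> \<and> (?E \<tau> \<and> (?S \<longrightarrow> ?U \<tau>))"
    by (rule eventually_conj[OF eventually_at_right_less])
  then show ?thesis
    by (rule eventually_happens'[OF trivial_limit_at_right_real, THEN exE]) blast
qed

end
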